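(* Let $n,N\ge 1$ be integers (not necessarily equal), $\eta,\hbar\in\mathbb{C}$ with $\sinh\eta\neq0$, $q=e^{\eta}$, and ${\bf g}=\mathrm{diag}(g_1,\dots,g_N)\in GL(N,\mathbb{C})$. Let $M_1,\dots,M_N$ be non-negative integers with $M_1+\dots+M_N=n$. Let $|\Phi\rangle=\sum_J\Phi_J|J\rangle$ be any solution, with values in the weight subspace ${\cal V}(\{M_a\})\subset(\mathbb{C}^N)^{\otimes n}$, of the trigonometric quantum Knizhnik-Zamolodchikov (qKZ) equations $$e^{\eta\hbar\partial_{x_i}}|\Phi\rangle={\bf K}_i^{(\hbar)}|\Phi\rangle,\qquad i=1,\dots,n.$$ Then the function $\Psi=\sum_J q^{\ell(J)}\Phi_J$ satisfies $$\sum_{i=1}^n\Bigl(\prod_{j\ne i}\frac{\sinh(x_i-x_j+\eta)}{\sinh(x_i-x_j)}\Bigr)\Psi(x_1,\dots,x_i+\eta\hbar,\dots,x_n)=E\,\Psi(x_1,\dots,x_n),\qquad E=\sum_{a=1}^N g_a\frac{\sinh(\eta M_a)}{\sinh\eta}.$$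
   Context: Let $V=\mathbb{C}^N$ with standard basis $e_1,\dots,e_N$, ${\cal V}=V^{\otimes n}$, and let $e_{ab}$ be the $N\times N$ matrix units, $e_{ab}e_c=\delta_{bc}e_a$. The trigonometric $R$-matrix is the operator on $V\otimes V$ $${\bf R}(x)=\sum_{a=1}^N e_{aa}\otimes e_{aa}+\frac{\sinh x}{\sinh(x+\eta)}\sum_{a\ne b}e_{aa}\otimes e_{bb}+\frac{\sinh\eta}{\sinh(x+\eta)}\sum_{a<b}\bigl(e^{x}e_{ab}\otimes e_{ba}+e^{-x}e_{ba}\otimes e_{ab}\bigr),$$ with all indices $a,b$ running over $1,\dots,N$. For $1\le i\ne j\le n$, ${\bf R}_{ij}(x)$ denotes the operator on ${\cal V}$ acting as ${\bf R}(x)$ with its first tensor component acting in the $i$-th factor and its second tensor component in the $j$-th factor, and identically on the other factors (the order of $i,j$ matters). ${\bf g}^{(i)}$ acts as ${\bf g}$ on the $i$-th factor and identically on the others. The qKZ operators are, for $i=1,\dots,n$, $${\bf K}_i^{(\hbar)}={\bf R}_{i\,i-1}(x_i-x_{i-1}+\eta\hbar)\cdots{\bf R}_{i1}(x_i-x_1+\eta\hbar)\,{\bf g}^{(i)}\,{\bf R}_{in}(x_i-x_n)\cdots{\bf R}_{i\,i+1}(x_i-x_{i+1}),$$ where the product to the left of ${\bf g}^{(i)}$ has second indices decreasing from $i-1$ to $1$ (empty for $i=1$) and the product to the right has second indices decreasing from $n$ to $i+1$ (empty for $i=n$). The operator $e^{\eta\hbar\partial_{x_i}}$ is the shift $(e^{\eta\hbar\partial_{x_i}}f)(x_1,\dots,x_n)=f(x_1,\dots,x_i+\eta\hbar,\dots,x_n)$.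 Weight subspaces: ${\cal V}(\{M_a\})$ is the span of the vectors $|J\rangle=e_{j_1}\otimes\dots\otimes e_{j_n}$ over all multi-indices $J=(j_1,\dots,j_n)\in\{1,\dots,N\}^n$ in which the value $a$ occurs exactly $M_a$ times, for every $a=1,\dots,N$. Sums over $J$ are over these multi-indices. $\ell(J)$ is the minimal number of elementary permutations (transpositions of neighbouring entries) required to obtain $J$ from the minimal multi-index, i.e. the weakly increasing one $1\le j_1\le j_2\le\dots\le j_n\le N$ with the same multiplicities $M_a$. Domain convention: $\Phi_J$ are complex-valued functions on a set $X\subset\mathbb{C}^n$ that is mapped to itself by each shift $x_i\mapsto x_i+\eta\hbar$ and on which the points are in general position, i.e. $\sinh(x_i-x_j)\ne0$ and $\sinh(x_i-x_j\pm\eta)\ne0$ for all $i\ne j$. All equations are understood to hold at every point of $X$. *)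

theory Defs
  imports Complex_Main "HOL-Library.FuncSet"
begin

text \<open>
  Points of \<open>\<complex>\<^sup>n\<close> are the functions in \<open>{1..n} \<rightarrow>\<^sub>E UNIV\<close>, multi-indices
  \<open>J = (j\<^sub>1, \<dots>, j\<^sub>n)\<close> are the functions in \<open>{1..n} \<rightarrow>\<^sub>E {1..N}\<close>, and an element of
  \<open>V\<^sup>\<otimes>\<^sup>n\<close>, \<open>V = \<complex>\<^sup>N\<close>, is given by its coordinates with respect to the basis of
  the vectors \<open>|J\<rangle>\<close>. Only the coordinates at multi-indices are meaningful.
  Matrices on \<open>V\<close> and on \<open>V \<otimes> V\<close> are indexed by \<open>{1..N}\<close> and by \<open>{1..N} \<times> {1..N}\<close>;
  the row index comes first.
\<close>

type_synonym point = "nat \<Rightarrow> complex"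
type_synonym multi_index = "nat \<Rightarrow> nat"
type_synonym tensor_vec = "multi_index \<Rightarrow> complex"
type_synonym mat1 = "nat \<Rightarrow> nat \<Rightarrow> complex"
type_synonym mat2 = "nat \<times> nat \<Rightarrow> nat \<times> nat \<Rightarrow> complex"

definition mat_unit :: "nat \<Rightarrow> nat \<Rightarrow> mat1" where
  "mat_unit a b = (\<lambda>r s. if r = a \<and> s = b then 1 else 0)"

definition tensor_mat :: "mat1 \<Rightarrow> mat1 \<Rightarrow> mat2" (infixr "\<otimes>\<^sub>m" 75) where
  "A \<otimes>\<^sub>m B = (\<lambda>(r, r') (s, s'). A r s * B r' s')"

definition diag_matrix :: "nat \<Rightarrow> (nat \<Rightarrow> complex) \<Rightarrow> mat1" where
  "diag_matrix N g = (\<lambda>r s. \<Sum>a\<in>{1..N}. g a * mat_unit a a r s)"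

definition GL :: "nat \<Rightarrow> mat1 set" where
  "GL N = {A. \<exists>B. \<forall>a\<in>{1..N}. \<forall>b\<in>{1..N}.
      (\<Sum>c\<in>{1..N}. A a c * B c b) = (if a = b then 1 else 0) \<and>
      (\<Sum>c\<in>{1..N}. B a c * A c b) = (if a = b then 1 else 0)}"

definition trig_R :: "nat \<Rightarrow> complex \<Rightarrow> complex \<Rightarrow> mat2" where
  "trig_R N \<eta> x = (\<lambda>r s.
      (\<Sum>a\<in>{1..N}. (mat_unit a a \<otimes>\<^sub>m mat_unit a a) r s)
    + sinh x / sinh (x + \<eta>) *
      (\<Sum>a\<in>{1..N}. \<Sum>b\<in>{1..N} - {a}. (mat_unit a a \<otimes>\<^sub>m mat_unit b b) r s)
    + sinh \<eta> / sinh (x + \<eta>) *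
      (\<Sum>a\<in>{1..N}. \<Sum>b\<in>{a<..N}.
         exp x * (mat_unit a b \<otimes>\<^sub>m mat_unit b a) r s
       + exp (- x) * (mat_unit b a \<otimes>\<^sub>m mat_unit a b) r s))"

definition act_on :: "nat \<Rightarrow> mat1 \<Rightarrow> nat \<Rightarrow> tensor_vec \<Rightarrow> tensor_vec" where
  "act_on N A i v = (\<lambda>J. \<Sum>a\<in>{1..N}. A (J i) a * v (J(i := a)))"

definition act_on2 :: "nat \<Rightarrow> mat2 \<Rightarrow> nat \<Rightarrow> nat \<Rightarrow> tensor_vec \<Rightarrow> tensor_vec" where
  "act_on2 N B i j v =
     (\<lambda>J. \<Sum>a\<in>{1..N}. \<Sum>b\<in>{1..N}. B (J i, J j) (a, b) * v (J(i := a, j := b)))"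

text \<open>Product of a list of operators; the head of the list is the leftmost factor.\<close>

definition op_prod :: "(tensor_vec \<Rightarrow> tensor_vec) list \<Rightarrow> tensor_vec \<Rightarrow> tensor_vec" where
  "op_prod fs = foldr (\<circ>) fs id"

definition qKZ_op ::
  "nat \<Rightarrow> nat \<Rightarrow> complex \<Rightarrow> complex \<Rightarrow> (nat \<Rightarrow> complex) \<Rightarrow> nat \<Rightarrow> point \<Rightarrow> tensor_vec \<Rightarrow> tensor_vec"
where
  "qKZ_op n N \<eta> hbar g i x =
     op_prod (map (\<lambda>j. act_on2 N (trig_R N \<eta> (x i - x j + \<eta> * hbar)) i j) (rev [1..<i]))
   \<circ> act_on N (diag_matrix N g) i
   \<circ> op_prod (map (\<lambda>j. act_on2 N (trig_R N \<eta> (x i - x j)) i j) (rev [i+1..<n+1]))"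

definition shift :: "complex \<Rightarrow> nat \<Rightarrow> (point \<Rightarrow> 'a) \<Rightarrow> point \<Rightarrow> 'a" where
  "shift s i f = (\<lambda>x. f (x(i := x i + s)))"

definition multi_indices :: "nat \<Rightarrow> nat \<Rightarrow> multi_index set" where
  "multi_indices n N = {1..n} \<rightarrow>\<^sub>E {1..N}"

definition occurrences :: "nat \<Rightarrow> multi_index \<Rightarrow> nat \<Rightarrow> nat" where
  "occurrences n J a = card {i \<in> {1..n}. J i = a}"

definition weight_indices :: "nat \<Rightarrow> nat \<Rightarrow> (nat \<Rightarrow> nat) \<Rightarrow> multi_index set" where
  "weight_indices n N M =
     {J \<in> multi_indices n N. \<forall>a\<in>{1..N}. occurrences n J a = M a}"

definition ket :: "multi_index \<Rightarrow> tensor_vec" where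
  "ket J = (\<lambda>K. if K = J then 1 else 0)"

definition weight_subspace :: "nat \<Rightarrow> nat \<Rightarrow> (nat \<Rightarrow> nat) \<Rightarrow> tensor_vec set" where
  "weight_subspace n N M =
     {v. \<exists>c :: multi_index \<Rightarrow> complex. v = (\<lambda>K. \<Sum>J\<in>weight_indices n N M. c J * ket J K)}"

definition is_minimal_for :: "nat \<Rightarrow> multi_index \<Rightarrow> multi_index \<Rightarrow> bool" where
  "is_minimal_for n J\<^sub>0 J \<longleftrightarrow>
     J\<^sub>0 \<in> extensional {1..n} \<and> mono_on {1..n} J\<^sub>0 \<and>
     (\<forall>a. occurrences n J\<^sub>0 a = occurrences n J a)"

definition neighbour_swaps :: "nat \<Rightarrow> (multi_index \<times> multi_index) set" where
  "neighbour_swaps n =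
     {(J, J(m := J (m + 1), m + 1 := J m)) | J m. 1 \<le> m \<and> m < n}"

definition ell :: "nat \<Rightarrow> multi_index \<Rightarrow> nat" where
  "ell n J = (LEAST k. \<exists>J\<^sub>0. is_minimal_for n J\<^sub>0 J \<and> (J\<^sub>0, J) \<in> neighbour_swaps n ^^ k)"

definition admissible_domain :: "nat \<Rightarrow> complex \<Rightarrow> complex \<Rightarrow> point set \<Rightarrow> bool" where
  "admissible_domain n \<eta> hbar X \<longleftrightarrow>
     X \<subseteq> {1..n} \<rightarrow>\<^sub>E UNIV \<and>
     (\<forall>x\<in>X. \<forall>i\<in>{1..n}. x(i := x i + \<eta> * hbar) \<in> X) \<and>
     (\<forall>x\<in>X. \<forall>i\<in>{1..n}. \<forall>j\<in>{1..n}. i \<noteq> j \<longrightarrow>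
        sinh (x i - x j) \<noteq> 0 \<and> sinh (x i - x j + \<eta>) \<noteq> 0 \<and> sinh (x i - x j - \<eta>) \<noteq> 0)"

definition solves_qKZ ::
  "nat \<Rightarrow> nat \<Rightarrow> complex \<Rightarrow> complex \<Rightarrow> (nat \<Rightarrow> complex) \<Rightarrow> point set \<Rightarrow> (point \<Rightarrow> tensor_vec) \<Rightarrow> bool"
where
  "solves_qKZ n N \<eta> hbar g X \<Phi> \<longleftrightarrow>
     (\<forall>i\<in>{1..n}. \<forall>x\<in>X. \<forall>J\<in>multi_indices n N.
        shift (\<eta> * hbar) i \<Phi> x J = qKZ_op n N \<eta> hbar g i x (\<Phi> x) J)"

end

theory Submission
  imports Defs "HOL-Computational_Algebra.Polynomial"
begin

text \<open>
  Let \<open>\<Omega> = \<Sum>\<^sub>J q\<^bsup>\<ell>(J)\<^esup> \<langle>J|\<close>. A direct computation gives \<open>\<Omega> R = \<Omega> P\<close> for the R-matrix acting in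
  adjacent factors, \<open>P\<close> being the permutation. Moving the permutations to the right, one finds that
  \<open>\<Omega> K\<^sub>i\<close> does not depend on the spectral parameters of the R-matrices to the left of \<open>g\<close>; hence
  \<open>\<Omega> K\<^sub>i\<close> does not depend on \<open>\<hbar>\<close>, and \<open>\<hbar>\<close> may be replaced by \<open>0\<close> in the operators. For \<open>\<hbar> = 0\<close>
  the operators, multiplied by the products of \<open>sinh (x\<^sub>i - x\<^sub>j + \<eta>) / sinh (x\<^sub>i - x\<^sub>j)\<close>, are the residues of the
  inhomogeneous transfer matrix \<open>T(x)\<close>, a rational function of \<open>z = e\<^bsup>2x\<^esup>\<close>. Their sum is thus
  determined by \<open>T(\<plusminus>\<infinity>)\<close>, where the monodromy matrix is triangular in the auxiliary space, so
  that \<open>T(\<plusminus>\<infinity>) = \<Sum>\<^sub>a g\<^sub>a q\<^bsup>\<plusminus>M\<^sub>a\<^esup>\<close> on the weight subspace.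
\<close>

section \<open>Length and inversions\<close>

definition swap_entries :: "nat \<Rightarrow> multi_index \<Rightarrow> multi_index" where
  "swap_entries m J = J(m := J (Suc m), Suc m := J m)"

definition adj_transp :: "nat \<Rightarrow> nat \<Rightarrow> nat" where
  "adj_transp m = id(m := Suc m, Suc m := m)"

definition inversions :: "nat \<Rightarrow> multi_index \<Rightarrow> (nat \<times> nat) set" where
  "inversions n J = {(i, j). 1 \<le> i \<and> i < j \<and> j \<le> n \<and> J j < J i}"

lemma swap_entries_swap_entries [simp]: "swap_entries m (swap_entries m J) = J"
  by (auto simp: swap_entries_def fun_eq_iff)

lemma adj_transp_adj_transp [simp]: "adj_transp m (adj_transp m i) = i"
  by (auto simp: adj_transp_def)

lemma inj_adj_transp: "inj_on (adj_transp m) A"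
  by (metis adj_transp_adj_transp inj_onI)

lemma swap_entries_adj_transp: "swap_entries m J (adj_transp m i) = J i"
  by (auto simp: swap_entries_def adj_transp_def)

lemma swap_entries_conv_adj_transp: "swap_entries m J i = J (adj_transp m i)"
  by (auto simp: swap_entries_def adj_transp_def)

lemma adj_transp_less:
  "i < j \<Longrightarrow> (i, j) \<noteq> (m, Suc m) \<Longrightarrow> adj_transp m i < adj_transp m j"
  by (auto simp: adj_transp_def)

lemma adj_transp_range:
  assumes "1 \<le> m" "m < n"
  shows "Suc 0 \<le> adj_transp m i \<longleftrightarrow> Suc 0 \<le> i" "adj_transp m i \<le> n \<longleftrightarrow> i \<le> n"
  using assms by (auto simp: adj_transp_def)

lemma finite_inversions [simp]: "finite (inversions n J)"
  by (rule finite_subset[of _ "{..n} \<times> {..n}"]) (auto simp: inversions_def)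

text \<open>An adjacent transposition of positions keeps the order of every other pair of positions,
  so existing inversions are merely relabelled; the pair \<open>(m, Suc m)\<close> is an ascent of
  \<open>J\<close> and becomes a new inversion.\<close>

lemma inversions_swap_entries:
  assumes m: "1 \<le> m" "m < n" and asc: "J m < J (Suc m)"
  shows "inversions n (swap_entries m J) =
    insert (m, Suc m) (map_prod (adj_transp m) (adj_transp m) ` inversions n J)"
proof (intro equalityI subsetI)
  fix p assume "p \<in> inversions n (swap_entries m J)"
  then obtain i j where p: "p = (i, j)" "1 \<le> i" "i < j" "j \<le> n"
    "J (adj_transp m j) < J (adj_transp m i)"
    by (auto simp: inversions_def swap_entries_conv_adj_transp)
  show "p \<in> insert (m, Suc m) (map_prod (adj_transp m) (adj_transp m) ` inversions n J)"
  proof (cases "p = (m, Suc m)")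
    case False
    then have "(adj_transp m i, adj_transp m j) \<in> inversions n J"
      using p m by (auto simp: inversions_def adj_transp_range[OF m] adj_transp_less)
    from imageI[OF this, of "map_prod (adj_transp m) (adj_transp m)"] show ?thesis
      by (simp add: p(1))
  qed simp
next
  fix p assume "p \<in> insert (m, Suc m) (map_prod (adj_transp m) (adj_transp m) ` inversions n J)"
  then consider "p = (m, Suc m)"
    | i j where "p = (adj_transp m i, adj_transp m j)" "1 \<le> i" "i < j" "j \<le> n" "J j < J i"
    by (auto simp: inversions_def)
  then show "p \<in> inversions n (swap_entries m J)"
  proof cases
    case 1
    then show ?thesis using m asc by (auto simp: inversions_def swap_entries_def)
  next
    case 2
    moreover from 2 asc have "(i, j) \<noteq> (m, Suc m)" by auto
    ultimately show ?thesis
      by (auto simp: inversions_def swap_entries_adj_transp adj_transp_range[OF m]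
          adj_transp_less)
  qed
qed

lemma card_inversions_swap_entries:
  assumes m: "1 \<le> m" "m < n" and asc: "J m < J (Suc m)"
  shows "card (inversions n (swap_entries m J)) = Suc (card (inversions n J))"
proof -
  let ?f = "map_prod (adj_transp m) (adj_transp m)"
  \<comment> \<open>The only pair that \<open>?f\<close> sends there is \<open>(Suc m, m)\<close>,
    which is not in increasing order.\<close>
  have "(m, Suc m) \<notin> ?f ` inversions n J"
    by (auto simp: inversions_def adj_transp_def split: if_splits)
  moreover have "inj_on ?f (inversions n J)"
    using map_prod_inj_on[OF inj_adj_transp inj_adj_transp] by (rule inj_on_subset) auto
  ultimately show ?thesis
    by (simp add: inversions_swap_entries[OF assms] card_image)
qed

text \<open>An ascent gains one inversion, equal entries change nothing, and a descent loses one
  because undoing it is an ascent.\<close>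

lemma card_inversions_swap_le:
  assumes m: "1 \<le> m" "m < n"
  shows "card (inversions n (swap_entries m J)) \<le> Suc (card (inversions n J))"
proof (cases "J m" "J (Suc m)" rule: linorder_cases)
  case less
  then show ?thesis using card_inversions_swap_entries[OF m less] by simp
next
  case equal
  then have "swap_entries m J = J" by (auto simp: swap_entries_def)
  then show ?thesis by simp
next
  case greater
  then have "swap_entries m J m < swap_entries m J (Suc m)"
    by (simp add: swap_entries_def)
  from card_inversions_swap_entries[OF m this] show ?thesis by simp
qed

lemma occurrences_swap_entries:
  assumes m: "1 \<le> m" "m < n"
  shows "occurrences n (swap_entries m J) a = occurrences n J a"
proof -
  have "{i \<in> {1..n}. swap_entries m J i = a} = adj_transp m ` {i \<in> {1..n}. J i = a}"
  proof (intro equalityI subsetI)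
    fix i assume "i \<in> {i \<in> {1..n}. swap_entries m J i = a}"
    then have "adj_transp m i \<in> {i \<in> {1..n}. J i = a}"
      by (auto simp: swap_entries_conv_adj_transp adj_transp_range[OF m])
    from imageI[OF this, of "adj_transp m"]
    show "i \<in> adj_transp m ` {i \<in> {1..n}. J i = a}" by simp
  qed (auto simp: swap_entries_adj_transp adj_transp_range[OF m])
  then show ?thesis by (simp add: occurrences_def card_image inj_adj_transp)
qed

lemma neighbour_swaps_iff:
  "(J, K) \<in> neighbour_swaps n \<longleftrightarrow> (\<exists>m. 1 \<le> m \<and> m < n \<and> K = swap_entries m J)"
  by (auto simp: neighbour_swaps_def swap_entries_def)

lemma ascending_imp_mono_on:
  assumes "\<And>m. 1 \<le> m \<Longrightarrow> m < n \<Longrightarrow> J m \<le> J (Suc m)"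
  shows "mono_on {1..n} (J :: multi_index)"
proof (rule mono_onI)
  fix r s assume rs: "r \<in> {1..n}" "s \<in> {1..n}" "r \<le> s"
  from rs(3,2) show "J r \<le> J s"
  proof (induction s rule: dec_induct)
    case (step k)
    then show ?case using assms[of k] rs(1) by auto
  qed simp
qed

lemma inversions_eq_empty:
  assumes "mono_on {1..n} J"
  shows "inversions n J = {}"
proof -
  have "\<not> J j < J i" if "1 \<le> i" "i < j" "j \<le> n" for i j
    using mono_onD[OF assms, of i j] that by simp
  then show ?thesis by (auto simp: inversions_def)
qed

text \<open>Bubble sort: an unsorted \<open>J\<close> has a descent at neighbouring positions, and
  swapping it removes exactly one inversion. This bounds \<open>ell\<close> from above.\<close>

lemma sorting_path:
  assumes "J \<in> extensional {1..n}"
  shows "\<exists>J\<^sub>0. is_minimal_for n J\<^sub>0 J \<and> (J\<^sub>0, J) \<in> neighbour_swaps n ^^ card (inversions n J)"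
  using assms
proof (induction "card (inversions n J)" arbitrary: J)
  case 0
  have "J m \<le> J (Suc m)" if "1 \<le> m" "m < n" for m
  proof (rule ccontr)
    assume "\<not> J m \<le> J (Suc m)"
    with that have "(m, Suc m) \<in> inversions n J" by (auto simp: inversions_def)
    with 0 show False by auto
  qed
  then have "mono_on {1..n} J" by (rule ascending_imp_mono_on)
  with 0 have "is_minimal_for n J J" by (simp add: is_minimal_for_def)
  with 0 show ?case by auto
next
  case (Suc k)
  have "\<not> mono_on {1..n} J"
    using inversions_eq_empty[of n J] Suc(2) by auto
  then obtain m where m: "1 \<le> m" "m < n" "J (Suc m) < J m"
    using ascending_imp_mono_on[of n J] by (meson not_le)
  define K where "K = swap_entries m J"
  have JK: "J = swap_entries m K" by (simp add: K_def)
  have "K m < K (Suc m)" using m by (simp add: K_def swap_entries_def)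
  from card_inversions_swap_entries[OF m(1,2) this] have k: "card (inversions n K) = k"
    using Suc(2) JK by simp
  have "K \<in> extensional {1..n}"
    using Suc(3) m by (auto simp: K_def swap_entries_def extensional_def)
  from Suc(1)[OF k[symmetric] this] obtain J\<^sub>0
    where J0: "is_minimal_for n J\<^sub>0 K" "(J\<^sub>0, K) \<in> neighbour_swaps n ^^ k"
    using k by auto
  have "is_minimal_for n J\<^sub>0 J"
    using J0(1) occurrences_swap_entries[OF m(1,2), of K]
    by (auto simp: is_minimal_for_def JK)
  moreover have "(J\<^sub>0, J) \<in> neighbour_swaps n ^^ Suc k"
    using J0(2) m JK neighbour_swaps_iff by (blast intro: relpow_Suc_I)
  ultimately show ?case using Suc(2) by auto
qed

lemma card_inversions_path:
  "(J\<^sub>0, J) \<in> neighbour_swaps n ^^ k \<Longrightarrow> card (inversions n J) \<le> card (inversions n J\<^sub>0) + k"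
proof (induction k arbitrary: J)
  case (Suc k)
  then obtain K m where "(J\<^sub>0, K) \<in> neighbour_swaps n ^^ k" "1 \<le> m" "m < n" "J = swap_entries m K"
    by (auto simp: neighbour_swaps_iff)
  then show ?case
    using Suc.IH[of K] card_inversions_swap_le[of m n K] by simp
qed simp

text \<open>\<open>sorting_path\<close> attains the value, and \<open>card_inversions_path\<close>
  excludes shorter paths, since a sorted start has no inversions.\<close>

lemma ell_eq_card_inversions:
  assumes "J \<in> extensional {1..n}"
  shows "ell n J = card (inversions n J)"
  unfolding ell_def
proof (rule Least_equality)
  show "\<exists>J\<^sub>0. is_minimal_for n J\<^sub>0 J \<and> (J\<^sub>0, J) \<in> neighbour_swaps n ^^ card (inversions n J)"
    using assms by (rule sorting_path)
next
  fix k assume "\<exists>J\<^sub>0. is_minimal_for n J\<^sub>0 J \<and> (J\<^sub>0, J) \<in> neighbour_swaps n ^^ k"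
  then obtain J\<^sub>0 where "is_minimal_for n J\<^sub>0 J" "(J\<^sub>0, J) \<in> neighbour_swaps n ^^ k" by auto
  then show "card (inversions n J) \<le> k"
    using card_inversions_path[of J\<^sub>0 J k n] inversions_eq_empty[of n J\<^sub>0]
    by (simp add: is_minimal_for_def)
qed

section \<open>Six-vertex form of the R-matrix\<close>

text \<open>\<open>c\<close> and \<open>d\<close> are the weights of \<open>e\<^sub>r\<^sub>s \<otimes> e\<^sub>s\<^sub>r\<close> for \<open>r < s\<close> and for \<open>r > s\<close>.\<close>

definition six_vertex ::
  "'a::zero \<Rightarrow> 'a \<Rightarrow> 'a \<Rightarrow> 'a \<Rightarrow> nat \<times> nat \<Rightarrow> nat \<times> nat \<Rightarrow> 'a" where
  "six_vertex a b c d = (\<lambda>(r, s) (r', s').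
     if r' = r \<and> s' = s then (if r = s then a else b)
     else if r' = s \<and> s' = r then (if r < s then c else d) else 0)"

lemma sum_diag_units:
  assumes "finite A" "r \<in> A"
  shows "(\<Sum>a\<in>A. (mat_unit a a \<otimes>\<^sub>m mat_unit a a) (r, s) (r', s')) =
    of_bool (r = s \<and> r' = r \<and> s' = s)"
proof -
  have "(mat_unit a a \<otimes>\<^sub>m mat_unit a a) (r, s) (r', s') =
    (if a = r then of_bool (r = s \<and> r' = r \<and> s' = s) else 0)" for a
    by (auto simp: mat_unit_def tensor_mat_def)
  then show ?thesis using assms by simp
qed

text \<open>The row indices select at most the term \<open>a = r\<close>, \<open>b = s\<close>. The
  inner range may depend on \<open>a\<close>, as it does in the sums over
  \<open>a < b\<close>.\<close>

lemma sum_sum_units: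
  assumes "finite A" "r \<in> A" "\<And>a. finite (S a)"
    and T: "\<And>a b. T a b = (if b = s then if a = r then C else 0 else (0::complex))"
  shows "(\<Sum>a\<in>A. \<Sum>b\<in>S a. T a b) = (if s \<in> S r then C else 0)"
proof -
  have "(\<Sum>b\<in>S a. T a b) = (if a = r then if s \<in> S r then C else 0 else 0)" for a
    using assms(3) by (simp add: T)
  then show ?thesis using assms(1,2) by simp
qed

lemma trig_R_eq_six_vertex:
  assumes "r \<in> {1..N}" "s \<in> {1..N}"
  shows "trig_R N \<eta> y (r, s) p =
    six_vertex 1 (sinh y / sinh (y + \<eta>)) (sinh \<eta> / sinh (y + \<eta>) * exp y)
      (sinh \<eta> / sinh (y + \<eta>) * exp (- y)) (r, s) p"
proof -
  obtain r' s' where p: "p = (r', s')" by fastforce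
  have 1: "(\<Sum>a\<in>{1..N}. (mat_unit a a \<otimes>\<^sub>m mat_unit a a) (r, s) (r', s')) =
      of_bool (r = s \<and> r' = r \<and> s' = s)"
    using assms by (intro sum_diag_units) auto
  have 2: "(\<Sum>a\<in>{1..N}. \<Sum>b\<in>{1..N} - {a}. (mat_unit a a \<otimes>\<^sub>m mat_unit b b) (r, s) (r', s')) =
      (if s \<in> {1..N} - {r} then of_bool (r' = r \<and> s' = s) else 0)"
    using assms by (intro sum_sum_units) (auto simp: mat_unit_def tensor_mat_def)
  have 3: "(\<Sum>a\<in>{1..N}. \<Sum>b\<in>{a<..N}. exp y * (mat_unit a b \<otimes>\<^sub>m mat_unit b a) (r, s) (r', s')) =
      (if s \<in> {r<..N} then exp y * of_bool (r' = s \<and> s' = r) else 0)"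
    using assms by (intro sum_sum_units) (auto simp: mat_unit_def tensor_mat_def)
  have 4: "(\<Sum>a\<in>{1..N}. \<Sum>b\<in>{a<..N}. exp (- y) * (mat_unit b a \<otimes>\<^sub>m mat_unit a b) (r, s) (r', s')) =
      (if r \<in> {s<..N} then exp (- y) * of_bool (r' = s \<and> s' = r) else 0)"
    using assms by (intro sum_sum_units) (auto simp: mat_unit_def tensor_mat_def)
  have "trig_R N \<eta> y (r, s) p = of_bool (r = s \<and> r' = r \<and> s' = s)
      + sinh y / sinh (y + \<eta>) *
        (if s \<in> {1..N} - {r} then of_bool (r' = r \<and> s' = s) else 0)
      + sinh \<eta> / sinh (y + \<eta>) *
        ((if s \<in> {r<..N} then exp y * of_bool (r' = s \<and> s' = r) else 0)
       + (if r \<in> {s<..N} then exp (- y) * of_bool (r' = s \<and> s' = r) else 0))"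
    by (simp only: trig_R_def p sum.distrib 1 2 3 4)
  also have "\<dots> = six_vertex 1 (sinh y / sinh (y + \<eta>)) (sinh \<eta> / sinh (y + \<eta>) * exp y)
      (sinh \<eta> / sinh (y + \<eta>) * exp (- y)) (r, s) p"
  proof -
    have "of_bool (r = s \<and> r' = r \<and> s' = s)
      + B * (if s \<in> {1..N} - {r} then of_bool (r' = r \<and> s' = s) else 0)
      + C * ((if s \<in> {r<..N} then D * of_bool (r' = s \<and> s' = r) else 0)
       + (if r \<in> {s<..N} then F * of_bool (r' = s \<and> s' = r) else 0))
      = six_vertex 1 B (C * D) (C * F) (r, s) (r', s')" for B C D F :: complex
      using assms by (cases r s rule: linorder_cases) (auto simp: six_vertex_def)
    then show ?thesis unfolding p .
  qed
  finally show ?thesis .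
qed

lemma act_on2_six_vertex:
  assumes "J i \<in> {1..N}" "J j \<in> {1..N}"
  shows "act_on2 N (six_vertex a b c d) i j v J =
    (if J i = J j then a * v J
     else b * v J + (if J i < J j then c else d) * v (J(i := J j, j := J i)))"
proof -
  let ?r = "J i" and ?s = "J j"
  \<comment> \<open>By the ice rule only the columns \<open>(?r, ?s)\<close> and
    \<open>(?s, ?r)\<close> contribute. They coincide when \<open>?r = ?s\<close>, so the second
    term is set to 0 there to avoid counting it twice.\<close>
  have "act_on2 N (six_vertex a b c d) i j v J =
      (\<Sum>r'\<in>{1..N}. \<Sum>s'\<in>{1..N}.
        (if s' = ?s then if r' = ?r then (if ?r = ?s then a else b) * v J else 0 else 0) +
        (if s' = ?r then if r' = ?s then
          (if ?r = ?s then 0 else if ?r < ?s then c else d) * v (J(i := ?s, j := ?r)) else 0 else 0))"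
    unfolding act_on2_def by (intro sum.cong refl) (auto simp: six_vertex_def)
  also have "\<dots> = (if ?r = ?s then a else b) * v J +
      (if ?r = ?s then 0 else if ?r < ?s then c else d) * v (J(i := ?s, j := ?r))"
    using assms by (simp add: sum.distrib)
  finally show ?thesis by simp
qed

lemma act_on2_trig_R:
  assumes "J i \<in> {1..N}" "J j \<in> {1..N}"
  shows "act_on2 N (trig_R N \<eta> y) i j v J =
    (if J i = J j then v J
     else sinh y / sinh (y + \<eta>) * v J +
       sinh \<eta> / sinh (y + \<eta>) * (if J i < J j then exp y else exp (- y)) *
         v (J(i := J j, j := J i)))"
proof -
  have "act_on2 N (trig_R N \<eta> y) i j v J =
    act_on2 N (six_vertex 1 (sinh y / sinh (y + \<eta>)) (sinh \<eta> / sinh (y + \<eta>) * exp y)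
      (sinh \<eta> / sinh (y + \<eta>) * exp (- y))) i j v J"
    unfolding act_on2_def using assms by (simp add: trig_R_eq_six_vertex)
  then show ?thesis using assms by (auto simp: act_on2_six_vertex)
qed

section \<open>The q-symmetric covector\<close>

text \<open>The pairing with the covector \<Omega> on the weight subspace. The exponent is the
  number of inversions, which equals \<open>ell n J\<close> on these indices and is easy to follow
  under swaps.\<close>

definition q_pairing :: "nat \<Rightarrow> nat \<Rightarrow> (nat \<Rightarrow> nat) \<Rightarrow> complex \<Rightarrow> tensor_vec \<Rightarrow> complex" where
  "q_pairing n N M q v = (\<Sum>J\<in>weight_indices n N M. q ^ card (inversions n J) * v J)"

lemma swap_entries_weight_indices:
  assumes "1 \<le> m" "m < n" "J \<in> weight_indices n N M"
  shows "swap_entries m J \<in> weight_indices n N M"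
proof -
  have "swap_entries m J \<in> multi_indices n N"
    using assms unfolding weight_indices_def multi_indices_def
    by (auto simp: swap_entries_def PiE_iff extensional_def)
  then show ?thesis
    using assms by (simp add: weight_indices_def occurrences_swap_entries)
qed

lemma multi_indices_range: "J \<in> multi_indices n N \<Longrightarrow> i \<in> {1..n} \<Longrightarrow> J i \<in> {1..N}"
  by (auto simp: multi_indices_def)

text \<open>The scalar identities behind \<Omega> R = \<Omega> P: the first serves a descent
  \<open>J (Suc m) < J m\<close>, the second an ascent.\<close>

lemma sinh_exp_identity:
  fixes y \<eta> :: complex
  shows "exp \<eta> * sinh y + sinh \<eta> * exp (- y) = sinh (y + \<eta>)"
    and "sinh y + exp \<eta> * (sinh \<eta> * exp y) = exp \<eta> * sinh (y + \<eta>)"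
proof -
  have e: "exp (- y) = cosh y - sinh y" "exp y = cosh y + sinh y" "exp \<eta> = cosh \<eta> + sinh \<eta>"
    by (simp_all add: cosh_minus_sinh cosh_plus_sinh)
  show "exp \<eta> * sinh y + sinh \<eta> * exp (- y) = sinh (y + \<eta>)"
    unfolding e sinh_add by (simp add: algebra_simps)
  have "sinh y * (cosh \<eta> * cosh \<eta> - sinh \<eta> * sinh \<eta>) = sinh y"
    using hyperbolic_pythagoras[of \<eta>] by (simp add: power2_eq_square)
  then show "sinh y + exp \<eta> * (sinh \<eta> * exp y) = exp \<eta> * sinh (y + \<eta>)"
    unfolding e sinh_add by (simp add: algebra_simps)
qed

text \<open>The coefficient of \<open>v J\<close> collects the diagonal weight at \<open>J\<close>
  and the exchange weight at the swapped index. For distinct entries the two powers of q differ by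
  one factor q, and \<open>sinh_exp_identity\<close> adds the contributions up to the power of the
  swapped index.\<close>

lemma q_pairing_trig_R:
  assumes m: "1 \<le> m" "m < n" and ne: "sinh (y + \<eta>) \<noteq> 0"
  shows "q_pairing n N M (exp \<eta>) (act_on2 N (trig_R N \<eta> y) (Suc m) m v) =
    q_pairing n N M (exp \<eta>) (\<lambda>J. v (swap_entries m J))"
proof -
  let ?W = "weight_indices n N M" and ?s = "swap_entries m"
  let ?w = "\<lambda>J. exp \<eta> ^ card (inversions n J)"
  let ?S = "sinh (y + \<eta>)"
  define A where "A J = (if J (Suc m) = J m then 1 else sinh y / ?S)" for J :: multi_index
  define B where "B J = (if J (Suc m) = J m then 0 else
    sinh \<eta> / ?S * (if J (Suc m) < J m then exp y else exp (- y)))" for J :: multi_index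
  have reindex: "(\<Sum>J\<in>?W. f (?s J)) = (\<Sum>J\<in>?W. f J)" for f :: "multi_index \<Rightarrow> complex"
    by (rule sum.reindex_bij_witness[of _ ?s ?s]) (auto intro: swap_entries_weight_indices m)
  have "q_pairing n N M (exp \<eta>) (act_on2 N (trig_R N \<eta> y) (Suc m) m v) =
      (\<Sum>J\<in>?W. ?w J * (A J * v J + B J * v (?s J)))"
    unfolding q_pairing_def
  proof (intro sum.cong refl, goal_cases)
    case (1 J)
    then have J: "J \<in> multi_indices n N" by (simp add: weight_indices_def)
    have "J (Suc m) \<in> {1..N}" "J m \<in> {1..N}"
      using m multi_indices_range[OF J, of m] multi_indices_range[OF J, of "Suc m"] by auto
    moreover have "J(Suc m := J m, m := J (Suc m)) = ?s J"
      by (auto simp: swap_entries_def)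
    ultimately show ?case by (simp add: act_on2_trig_R A_def B_def)
  qed
  \<comment> \<open>Inserting the double swap makes the second summand a function of
    \<open>?s J\<close>, so that \<open>reindex\<close> applies.\<close>
  also have "\<dots> = (\<Sum>J\<in>?W. ?w J * A J * v J) + (\<Sum>J\<in>?W. ?w (?s (?s J)) * B (?s (?s J)) * v (?s J))"
    by (simp add: sum.distrib algebra_simps)
  also have "\<dots> = (\<Sum>J\<in>?W. ?w J * A J * v J) + (\<Sum>J\<in>?W. ?w (?s J) * B (?s J) * v J)"
    by (subst reindex[of "\<lambda>J. ?w (?s J) * B (?s J) * v J"]) simp
  also have "\<dots> = (\<Sum>J\<in>?W. (?w J * A J + ?w (?s J) * B (?s J)) * v J)"
    by (simp add: sum.distrib algebra_simps)
  also have "\<dots> = (\<Sum>J\<in>?W. ?w (?s J) * v J)"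
  proof (intro sum.cong refl arg_cong2[where f = "(*)"], goal_cases)
    case (1 J)
    have sJ: "?s J m = J (Suc m)" "?s J (Suc m) = J m" by (simp_all add: swap_entries_def)
    show ?case
    proof (cases "J m" "J (Suc m)" rule: linorder_cases)
      case less
      then have "?w (?s J) = exp \<eta> * ?w J"
        by (simp add: card_inversions_swap_entries[OF m])
      moreover have "?w J * (sinh y + exp \<eta> * (sinh \<eta> * exp y)) = ?w J * (exp \<eta> * ?S)"
        by (simp only: sinh_exp_identity)
      ultimately show ?thesis
        using less ne by (simp add: A_def B_def sJ field_simps)
    next
      case equal
      then have "?s J = J" by (auto simp: swap_entries_def)
      then show ?thesis using equal by (simp add: A_def B_def)
    next
      case greater
      then have "?s J m < ?s J (Suc m)" by (simp add: sJ)
      from card_inversions_swap_entries[OF m this]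
      have "?w J = exp \<eta> * ?w (?s J)" by simp
      moreover have "?w (?s J) * (exp \<eta> * sinh y + sinh \<eta> * exp (- y)) = ?w (?s J) * ?S"
        by (simp only: sinh_exp_identity)
      ultimately show ?thesis
        using greater ne by (simp add: A_def B_def sJ field_simps)
    qed
  qed
  also have "\<dots> = (\<Sum>J\<in>?W. ?w (?s (?s J)) * v (?s J))"
    by (rule reindex[symmetric])
  finally show ?thesis by (simp add: q_pairing_def)
qed

section \<open>Removing the spectral parameters to the left of the twist\<close>

definition R_chain ::
  "nat \<Rightarrow> (nat \<Rightarrow> mat2) \<Rightarrow> nat \<Rightarrow> nat list \<Rightarrow> tensor_vec \<Rightarrow> tensor_vec" where
  "R_chain N B i ks = op_prod (map (\<lambda>j. act_on2 N (B j) i j) ks)"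

lemma R_chain_simps [simp]:
  "R_chain N B i [] v = v"
  "R_chain N B i (k # ks) v = act_on2 N (B k) i k (R_chain N B i ks v)"
  by (simp_all add: R_chain_def op_prod_def)

text \<open>The permutation of the factors \<open>i\<close> and \<open>Suc i\<close> conjugates each
  R-matrix acting in \<open>Suc i\<close>, \<open>k\<close> into the one acting in \<open>i\<close>,
  \<open>k\<close>, as \<open>k\<close> is neither of the two.\<close>

lemma R_chain_swap_entries:
  assumes "i \<notin> set ks" "Suc i \<notin> set ks"
  shows "R_chain N B (Suc i) ks v (swap_entries i J) =
    R_chain N B i ks (\<lambda>J. v (swap_entries i J)) J"
  using assms
proof (induction ks arbitrary: J)
  case (Cons k ks)
  have "(swap_entries i J)(Suc i := a, k := b) = swap_entries i (J(i := a, k := b))" for a b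
    using Cons.prems by (auto simp: swap_entries_def fun_eq_iff)
  moreover have "swap_entries i J (Suc i) = J i" "swap_entries i J k = J k"
    using Cons.prems by (auto simp: swap_entries_def)
  ultimately show ?case
    using Cons by (simp add: act_on2_def)
qed simp

text \<open>\<Omega> turns the leftmost R-matrix, which acts in neighbouring factors, into a
  permutation. Moved to the right, the permutation leaves a chain for \<open>i - 1\<close> of the
  same form and is absorbed into \<open>v\<close>, which is therefore arbitrary in the
  induction.\<close>

lemma q_pairing_R_chain_indep:
  assumes "1 \<le> i" "i \<le> n"
    and "\<And>j. 1 \<le> j \<Longrightarrow> j < i \<Longrightarrow> sinh (y j + \<eta>) \<noteq> 0 \<and> sinh (y' j + \<eta>) \<noteq> 0"
  shows "q_pairing n N M (exp \<eta>) (R_chain N (\<lambda>j. trig_R N \<eta> (y j)) i (rev [1..<i]) v) =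
    q_pairing n N M (exp \<eta>) (R_chain N (\<lambda>j. trig_R N \<eta> (y' j)) i (rev [1..<i]) v)"
  using assms
proof (induction i arbitrary: v rule: dec_induct)
  case (step i)
  have "rev [1..<Suc i] = i # rev [1..<i]" using step.hyps by simp
  with step show ?case
    by (simp add: q_pairing_trig_R R_chain_swap_entries)
qed simp

section \<open>The monodromy matrix\<close>

text \<open>The entry \<open>a\<close>, \<open>b\<close> in the auxiliary space of the ordered
  product of the \<open>B k\<close>, between the states \<open>J\<close> and \<open>J'\<close> of
  the sites in \<open>ks\<close>. Each site is met once when \<open>ks\<close> is distinct, so its
  states can be read off \<open>J\<close> and \<open>J'\<close>. The semiring is general in order to
  cover numbers and polynomials.\<close>

primrec monodromy ::
  "nat \<Rightarrow> (nat \<Rightarrow> nat \<times> nat \<Rightarrow> nat \<times> nat \<Rightarrow> 'a::comm_semiring_1) \<Rightarrow> nat list \<Rightarrow>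
    multi_index \<Rightarrow> multi_index \<Rightarrow> nat \<Rightarrow> nat \<Rightarrow> 'a" where
  "monodromy N B [] J J' = (\<lambda>a b. of_bool (a = b))"
| "monodromy N B (k # ks) J J' =
    (\<lambda>a b. \<Sum>c\<in>{1..N}. B k (a, J k) (c, J' k) * monodromy N B ks J J' c b)"

lemma monodromy_cong:
  assumes "\<And>k. k \<in> set ks \<Longrightarrow> J k = K k"
  shows "monodromy N B ks J J' = monodromy N B ks K J'"
  using assms by (induction ks) (simp_all add: fun_eq_iff)

lemma monodromy_append:
  assumes "a \<in> {1..N}"
  shows "monodromy N B (ks @ ls) J J' a b =
    (\<Sum>c\<in>{1..N}. monodromy N B ks J J' a c * monodromy N B ls J J' c b)"
  using assms
proof (induction ks arbitrary: a)
  case Nil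
  have "(\<Sum>c\<in>{1..N}. of_bool (a = c) * monodromy N B ls J J' c b) =
      (\<Sum>c\<in>{1..N}. if a = c then monodromy N B ls J J' c b else 0)"
    by (intro sum.cong) auto
  with Nil show ?case by simp
next
  case (Cons k ks)
  have "monodromy N B ((k # ks) @ ls) J J' a b =
     (\<Sum>d\<in>{1..N}. \<Sum>c\<in>{1..N}. B k (a, J k) (d, J' k) *
       monodromy N B ks J J' d c * monodromy N B ls J J' c b)"
    by (auto intro!: sum.cong simp: Cons.IH sum_distrib_left mult.assoc)
  also have "\<dots> = (\<Sum>c\<in>{1..N}. \<Sum>d\<in>{1..N}. B k (a, J k) (d, J' k) *
       monodromy N B ks J J' d c * monodromy N B ls J J' c b)"
    by (rule sum.swap)
  finally show ?case by (simp add: sum_distrib_right)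
qed

lemma monodromy_scale:
  assumes "\<And>k a p. k \<in> set ks \<Longrightarrow> a \<in> {1..N} \<Longrightarrow> B k (a, J k) p = s k * B' k (a, J k) p"
    and "a \<in> {1..N}"
  shows "monodromy N B ks J J' a b = prod_list (map s ks) * monodromy N B' ks J J' a b"
  using assms
proof (induction ks arbitrary: a)
  case (Cons k ks)
  then show ?case
    by (auto simp: sum_distrib_left mult_ac intro!: sum.cong)
qed simp

section \<open>Polynomial entries and triangular limits\<close>

lemma poly_monodromy:
  "poly (monodromy N B ks J J' a b) z =
    monodromy N (\<lambda>k p p'. poly (B k p p') (z :: complex)) ks J J' a b"
  by (induction ks arbitrary: a) (simp_all add: poly_sum)

lemma degree_monodromy_le:
  fixes B :: "nat \<Rightarrow> nat \<times> nat \<Rightarrow> nat \<times> nat \<Rightarrow> complex poly"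
  assumes "\<And>k p p'. degree (B k p p') \<le> 1"
  shows "degree (monodromy N B ks J J' a b) \<le> length ks"
proof (induction ks arbitrary: a)
  case (Cons k ks)
  have "degree (B k (a, J k) (c, J' k) * monodromy N B ks J J' c b) \<le> Suc (length ks)" for c
    using degree_mult_le[of "B k (a, J k) (c, J' k)" "monodromy N B ks J J' c b"]
      assms[of k "(a, J k)" "(c, J' k)"] Cons.IH[of c] by linarith
  then show ?case by (auto intro!: degree_sum_le)
qed simp

text \<open>With one linear factor per site, the top coefficient takes the linear coefficient of
  each factor: this is the monodromy matrix at infinity.\<close>

lemma coeff_monodromy:
  fixes B :: "nat \<Rightarrow> nat \<times> nat \<Rightarrow> nat \<times> nat \<Rightarrow> complex poly"
  assumes "\<And>k p p'. degree (B k p p') \<le> 1"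
  shows "coeff (monodromy N B ks J J' a b) (length ks) =
    monodromy N (\<lambda>k p p'. coeff (B k p p') 1) ks J J' a b"
proof (induction ks arbitrary: a)
  case (Cons k ks)
  have "coeff (P * Q) (Suc m) = coeff P 1 * coeff Q m"
    if "degree P \<le> 1" "degree Q \<le> m" for P Q :: "complex poly" and m
  proof -
    have P: "P = [:coeff P 0, coeff P 1:]"
      using that(1) by (intro poly_eqI) (auto simp: coeff_pCons coeff_eq_0 split: nat.splits)
    have "coeff Q (Suc m) = 0" using that(2) by (simp add: coeff_eq_0)
    then show ?thesis by (subst P) simp
  qed
  note * = this[OF assms degree_monodromy_le[where B = B, OF assms]]
  show ?case by (simp add: coeff_sum * Cons.IH)
qed simp

text \<open>No factor lowers the rank \<open>f\<close> of the auxiliary state, hence no product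
  does. The choices \<open>int\<close> and \<open>\<lambda>a. - int a\<close> give the two kinds of
  triangularity.\<close>

lemma monodromy_triangular:
  fixes f :: "nat \<Rightarrow> int"
  assumes tri: "\<And>k r s r' s'. f r' < f r \<Longrightarrow> B k (r, s) (r', s') = 0"
  shows "f b < f a \<Longrightarrow> monodromy N B ks J J' a b = 0"
proof (induction ks arbitrary: a)
  case (Cons k ks)
  have "B k (a, J k) (c, J' k) * monodromy N B ks J J' c b = 0" for c
    using Cons tri[of c a] by (cases "f c < f a") auto
  then show ?case by simp
qed auto

text \<open>A rank that never falls must stay constant on a path from \<open>a\<close> back to
  \<open>a\<close>; as \<open>f\<close> is injective, the auxiliary state is \<open>a\<close>
  throughout.\<close>

lemma monodromy_triangular_diag:
  fixes f :: "nat \<Rightarrow> int"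
  assumes tri: "\<And>k r s r' s'. f r' < f r \<Longrightarrow> B k (r, s) (r', s') = 0"
    and f: "inj f" and a: "a \<in> {1..N}"
  shows "monodromy N B ks J J' a a = (\<Prod>k\<leftarrow>ks. B k (a, J k) (a, J' k))"
proof (induction ks)
  case (Cons k ks)
  have "B k (a, J k) (c, J' k) * monodromy N B ks J J' c a = 0" if "c \<noteq> a" for c
  proof (cases "f c < f a")
    case False
    with that f have "f a < f c" by (metis injD linorder_neqE_linordered_idom)
    then show ?thesis using monodromy_triangular[of f B a c] tri by simp
  qed (simp add: tri)
  then have "monodromy N B (k # ks) J J' a a =
      (\<Sum>c\<in>{1..N}. if c = a then B k (a, J k) (a, J' k) * monodromy N B ks J J' a a else 0)"
    unfolding monodromy.simps by (intro sum.cong refl) auto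
  also have "\<dots> = B k (a, J k) (a, J' k) * monodromy N B ks J J' a a"
    using a by simp
  finally show ?case by (simp add: Cons.IH)
qed simp

text \<open>When the auxiliary state is \<open>a\<close> before and after a site, the ice rule keeps
  the state of the site as well, and an extra factor \<open>t\<close> arises exactly where that
  state is \<open>a\<close>.\<close>

lemma prod_list_six_vertex_diag:
  fixes u :: "nat \<Rightarrow> complex"
  assumes "distinct ks"
  shows "(\<Prod>k\<leftarrow>ks. six_vertex (u k * t) (u k) (c k) (d k) (a, J k) (a, J' k)) =
    of_bool (\<forall>k\<in>set ks. J k = J' k) * (\<Prod>k\<in>set ks. u k) * t ^ card {k \<in> set ks. J k = a}"
  using assms
proof (induction ks)
  case (Cons k ks)
  have "{j \<in> set (k # ks). J j = a} =
      (if J k = a then insert k {j \<in> set ks. J j = a} else {j \<in> set ks. J j = a})"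
    by auto
  moreover have "six_vertex (u k * t) (u k) (c k) (d k) (a, J k) (a, J' k) =
      of_bool (J k = J' k) * u k * (if J k = a then t else 1)"
    by (auto simp: six_vertex_def)
  ultimately show ?case using Cons by (auto simp: card_insert_if)
qed simp

section \<open>Matrix elements of the qKZ operators\<close>

lemma finite_multi_indices [simp]: "finite (multi_indices n N)"
  by (simp add: multi_indices_def finite_PiE)

lemma multi_indices_upd:
  "J \<in> multi_indices n N \<Longrightarrow> i \<in> {1..n} \<Longrightarrow> a \<in> {1..N} \<Longrightarrow> J(i := a) \<in> multi_indices n N"
  by (auto simp: multi_indices_def PiE_iff extensional_def)

text \<open>Factor \<open>i\<close> plays the auxiliary space. \<open>U\<close> changes only the
  factors \<open>i\<close> and \<open>S\<close>, and its kernel \<kappa> reads \<open>J\<close> only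
  at \<open>S\<close>; the chain then adds the sites \<open>ks\<close> and multiplies \<kappa> by
  its monodromy matrix. This is used once for each side of the twist.\<close>

lemma R_chain_kernel:
  assumes U: "\<And>J. J \<in> multi_indices n N \<Longrightarrow> U J = (\<Sum>J'\<in>multi_indices n N.
      of_bool (\<forall>l. l \<notin> insert i S \<longrightarrow> J' l = J l) * \<kappa> (J i) (J' i) J J' * v J')"
    and \<kappa>: "\<And>a b J K J'. (\<And>l. l \<in> S \<Longrightarrow> J l = K l) \<Longrightarrow> \<kappa> a b J J' = \<kappa> a b K J'"
    and "distinct ks" "set ks \<subseteq> {1..n}" "i \<in> {1..n}" "i \<notin> set ks" "i \<notin> S" "set ks \<inter> S = {}"
    and J: "J \<in> multi_indices n N"
  shows "R_chain N B i ks U J = (\<Sum>J'\<in>multi_indices n N.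
      of_bool (\<forall>l. l \<notin> insert i (set ks \<union> S) \<longrightarrow> J' l = J l) *
      (\<Sum>c\<in>{1..N}. monodromy N B ks J J' (J i) c * \<kappa> c (J' i) J J') * v J')"
  using assms(3-)
proof (induction ks arbitrary: J)
  case Nil
  have "(\<Sum>c\<in>{1..N}. of_bool (J i = c) * \<kappa> c (J' i) J J') = \<kappa> (J i) (J' i) J J'" for J'
  proof -
    have "(\<Sum>c\<in>{1..N}. of_bool (J i = c) * \<kappa> c (J' i) J J') =
        (\<Sum>c\<in>{1..N}. if J i = c then \<kappa> c (J' i) J J' else 0)"
      by (intro sum.cong) auto
    then show ?thesis using multi_indices_range[OF Nil.prems(7), of i] Nil.prems(3) by simp
  qed
  then show ?case using U[OF Nil.prems(7)] by simp
next
  case (Cons k ks)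
  let ?I = "multi_indices n N"
  note J = \<open>J \<in> ?I\<close>
  have ki: "k \<noteq> i" "k \<in> {1..n}" "k \<notin> set ks" "k \<notin> S" "i \<notin> set ks" "i \<notin> S" "i \<in> {1..n}"
    using Cons.prems by auto
  define P where "P J' \<longleftrightarrow> (\<forall>l. l \<notin> insert i (set (k # ks) \<union> S) \<longrightarrow> J' l = J l)" for J'
  define X where "X a J' = (\<Sum>c\<in>{1..N}. monodromy N B ks J J' a c * \<kappa> c (J' i) J J') * v J'" for a J'
  have IH: "R_chain N B i ks U (J(i := a, k := b)) =
      (\<Sum>J'\<in>?I. if J' k = b then of_bool (P J') * X a J' else 0)"
    if ab: "a \<in> {1..N}" "b \<in> {1..N}" for a b
  proof -
    define K where "K = J(i := a, k := b)"
    have K: "K \<in> ?I" "K i = a" "K k = b" "\<And>l. l \<noteq> i \<Longrightarrow> l \<noteq> k \<Longrightarrow> K l = J l"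
      unfolding K_def using J ab ki by (auto intro!: multi_indices_upd simp del: fun_upd_apply) auto
    have mon: "monodromy N B ks K J' = monodromy N B ks J J'" for J'
      using ki by (intro monodromy_cong K) auto
    have kap: "\<kappa> c d K J' = \<kappa> c d J J'" for c d J'
      using ki by (intro \<kappa> K) auto
    \<comment> \<open>Site \<open>k\<close> lies outside the sites of the shorter chain. Its
      condition \<open>J' k = b\<close> is split off, to collapse the sum over \<open>b\<close>
      later.\<close>
    have iff: "(\<forall>l. l \<notin> insert i (set ks \<union> S) \<longrightarrow> J' l = K l) \<longleftrightarrow> J' k = b \<and> P J'" for J'
      unfolding P_def using ki K(3,4) by (metis insert_iff list.simps(15) Un_iff)
    have "R_chain N B i ks U K = (\<Sum>J'\<in>?I.
      of_bool (\<forall>l. l \<notin> insert i (set ks \<union> S) \<longrightarrow> J' l = K l) *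
      (\<Sum>c\<in>{1..N}. monodromy N B ks K J' (K i) c * \<kappa> c (J' i) K J') * v J')"
      using Cons.prems K(1) by (intro Cons.IH) auto
    also have "\<dots> = (\<Sum>J'\<in>?I. if J' k = b then of_bool (P J') * X a J' else 0)"
    proof (intro sum.cong refl)
      fix J'
      show "of_bool (\<forall>l. l \<notin> insert i (set ks \<union> S) \<longrightarrow> J' l = K l) *
        (\<Sum>c\<in>{1..N}. monodromy N B ks K J' (K i) c * \<kappa> c (J' i) K J') * v J' =
        (if J' k = b then of_bool (P J') * X a J' else 0)"
        unfolding iff mon kap K(2) X_def by simp
    qed
    finally show ?thesis unfolding K_def .
  qed
  have "R_chain N B i (k # ks) U J =
      (\<Sum>a\<in>{1..N}. \<Sum>b\<in>{1..N}. \<Sum>J'\<in>?I.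
        if J' k = b then B k (J i, J k) (a, b) * (of_bool (P J') * X a J') else 0)"
    unfolding R_chain_simps act_on2_def
    by (intro sum.cong refl) (simp add: IH sum_distrib_left if_distrib mult.assoc cong: if_cong)
  also have "\<dots> = (\<Sum>a\<in>{1..N}. \<Sum>J'\<in>?I. \<Sum>b\<in>{1..N}.
        if J' k = b then B k (J i, J k) (a, b) * (of_bool (P J') * X a J') else 0)"
    by (intro sum.cong refl sum.swap)
  also have "\<dots> = (\<Sum>J'\<in>?I. \<Sum>a\<in>{1..N}. \<Sum>b\<in>{1..N}.
        if J' k = b then B k (J i, J k) (a, b) * (of_bool (P J') * X a J') else 0)"
    by (rule sum.swap)
  also have "\<dots> = (\<Sum>J'\<in>?I. \<Sum>a\<in>{1..N}. B k (J i, J k) (a, J' k) * (of_bool (P J') * X a J'))"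
    using multi_indices_range ki(2) by (auto intro!: sum.cong)
  also have "\<dots> = (\<Sum>J'\<in>?I. of_bool (P J') *
      (\<Sum>c\<in>{1..N}. monodromy N B (k # ks) J J' (J i) c * \<kappa> c (J' i) J J') * v J')"
  proof (intro sum.cong refl, goal_cases)
    case (1 J')
    have "(\<Sum>a\<in>{1..N}. B k (J i, J k) (a, J' k) * (of_bool (P J') * X a J')) =
      of_bool (P J') * (\<Sum>a\<in>{1..N}. \<Sum>c\<in>{1..N}.
        B k (J i, J k) (a, J' k) * monodromy N B ks J J' a c * \<kappa> c (J' i) J J') * v J'"
      unfolding X_def by (simp only: sum_distrib_left sum_distrib_right mult_ac)
    also have "(\<Sum>a\<in>{1..N}. \<Sum>c\<in>{1..N}.
        B k (J i, J k) (a, J' k) * monodromy N B ks J J' a c * \<kappa> c (J' i) J J') =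
      (\<Sum>c\<in>{1..N}. \<Sum>a\<in>{1..N}.
        B k (J i, J k) (a, J' k) * monodromy N B ks J J' a c * \<kappa> c (J' i) J J')"
      by (rule sum.swap)
    also have "\<dots> = (\<Sum>c\<in>{1..N}. monodromy N B (k # ks) J J' (J i) c * \<kappa> c (J' i) J J')"
      by (simp add: sum_distrib_right)
    finally show ?case .
  qed
  finally show ?case unfolding P_def .
qed

lemma act_on_diag_matrix:
  assumes "J i \<in> {1..N}"
  shows "act_on N (diag_matrix N g) i v J = g (J i) * v J"
proof -
  have "diag_matrix N g (J i) a = (if a = J i then g a else 0)" for a
  proof -
    have "diag_matrix N g (J i) a = (\<Sum>b\<in>{1..N}. if b = J i then if a = J i then g a else 0 else 0)"
      unfolding diag_matrix_def mat_unit_def by (intro sum.cong) auto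
    then show ?thesis using assms by simp
  qed
  then have "act_on N (diag_matrix N g) i v J =
      (\<Sum>a\<in>{1..N}. if a = J i then g a * v (J(i := a)) else 0)"
    unfolding act_on_def by (intro sum.cong) auto
  then show ?thesis using assms by simp
qed

lemma qKZ_op_R_chain:
  "qKZ_op n N \<eta> hbar g i x v =
    R_chain N (\<lambda>j. trig_R N \<eta> (x i - x j + \<eta> * hbar)) i (rev [1..<i])
      (act_on N (diag_matrix N g) i
        (R_chain N (\<lambda>j. trig_R N \<eta> (x i - x j)) i (rev [i+1..<n+1]) v))"
  by (simp add: qKZ_op_def R_chain_def)

text \<open>The matrix element between \<open>J\<close> and \<open>J'\<close> of the qKZ operator
  with \<hbar> = 0: factor \<open>i\<close> is the auxiliary space, and the twist sits between the
  two chains.\<close>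

definition qKZ_kernel ::
  "nat \<Rightarrow> nat \<Rightarrow> complex \<Rightarrow> (nat \<Rightarrow> complex) \<Rightarrow> nat \<Rightarrow> point \<Rightarrow> multi_index \<Rightarrow> multi_index \<Rightarrow> complex"
where
  "qKZ_kernel n N \<eta> g i x J J' = (let B = (\<lambda>j. trig_R N \<eta> (x i - x j)) in
    \<Sum>c\<in>{1..N}. monodromy N B (rev [1..<i]) J J' (J i) c *
      (g c * monodromy N B (rev [i+1..<n+1]) J J' c (J' i)))"

lemma qKZ_op_kernel:
  assumes i: "i \<in> {1..n}" and J: "J \<in> multi_indices n N"
  shows "qKZ_op n N \<eta> 0 g i x v J = (\<Sum>J'\<in>multi_indices n N. qKZ_kernel n N \<eta> g i x J J' * v J')"
proof -
  let ?I = "multi_indices n N"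
  let ?B = "\<lambda>j. trig_R N \<eta> (x i - x j)"
  let ?ks = "rev [i+1..<n+1]" and ?ls = "rev [1..<i]"
  \<comment> \<open>The identity as a kernel with \<open>S\<close> empty, from which the right chain
    is built.\<close>
  have base: "v J = (\<Sum>J'\<in>?I. of_bool (\<forall>l. l \<notin> insert i {} \<longrightarrow> J' l = J l) * of_bool (J i = J' i) * v J')"
    if "J \<in> ?I" for J
  proof -
    have "(\<forall>l. l \<notin> insert i {} \<longrightarrow> J' l = J l) \<and> J i = J' i \<longleftrightarrow> J = J'" for J'
      by (auto simp: fun_eq_iff)
    then have "of_bool (\<forall>l. l \<notin> insert i {} \<longrightarrow> J' l = J l) * of_bool (J i = J' i) * v J' =
        (if J = J' then v J' else 0)" for J'
      by (cases "J = J'") auto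
    with that show ?thesis by simp
  qed
  have right: "R_chain N ?B i ?ks v J = (\<Sum>J'\<in>?I. of_bool (\<forall>l. l \<notin> insert i (set ?ks) \<longrightarrow> J' l = J l) *
      monodromy N ?B ?ks J J' (J i) (J' i) * v J')" if "J \<in> ?I" for J
  proof -
    have "(\<Sum>c\<in>{1..N}. monodromy N ?B ?ks J J' (J i) c * of_bool (c = J' i)) =
        monodromy N ?B ?ks J J' (J i) (J' i)" if "J' \<in> ?I" for J'
    proof -
      have "(\<Sum>c\<in>{1..N}. monodromy N ?B ?ks J J' (J i) c * of_bool (c = J' i)) =
        (\<Sum>c\<in>{1..N}. if c = J' i then monodromy N ?B ?ks J J' (J i) c else 0)"
        by (intro sum.cong) auto
      then show ?thesis using multi_indices_range[OF that i] by simp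
    qed
    moreover have "R_chain N ?B i ?ks v J = (\<Sum>J'\<in>?I.
        of_bool (\<forall>l. l \<notin> insert i (set ?ks \<union> {}) \<longrightarrow> J' l = J l) *
        (\<Sum>c\<in>{1..N}. monodromy N ?B ?ks J J' (J i) c * of_bool (c = J' i)) * v J')"
      by (rule R_chain_kernel[where \<kappa> = "\<lambda>a b J J'. of_bool (a = b)", OF base]) (use i that in auto)
    ultimately show ?thesis by simp
  qed
  have mid: "act_on N (diag_matrix N g) i (R_chain N ?B i ?ks v) J =
      (\<Sum>J'\<in>?I. of_bool (\<forall>l. l \<notin> insert i (set ?ks) \<longrightarrow> J' l = J l) *
      (g (J i) * monodromy N ?B ?ks J J' (J i) (J' i)) * v J')" if "J \<in> ?I" for J
    using right[OF that] multi_indices_range[OF that i]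
    by (simp add: act_on_diag_matrix sum_distrib_left mult_ac)
  have cong: "g a * monodromy N ?B ?ks J J' a b = g a * monodromy N ?B ?ks K J' a b"
    if "\<And>l. l \<in> set ?ks \<Longrightarrow> J l = K l" for a b and J J' K :: multi_index
    by (subst monodromy_cong[of ?ks J K]) (use that in auto)
  have "qKZ_op n N \<eta> 0 g i x v J =
      (\<Sum>J'\<in>?I. of_bool (\<forall>l. l \<notin> insert i (set ?ls \<union> set ?ks) \<longrightarrow> J' l = J l) *
        (\<Sum>c\<in>{1..N}. monodromy N ?B ?ls J J' (J i) c * (g c * monodromy N ?B ?ks J J' c (J' i))) * v J')"
    unfolding qKZ_op_R_chain mult_zero_right add_0_right
    by (rule R_chain_kernel[where \<kappa> = "\<lambda>a b J J'. g a * monodromy N ?B ?ks J J' a b", OF mid cong])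
      (use i J in auto)
  \<comment> \<open>The sites used exhaust \<open>{1..n}\<close>, and outside it all multi-indices
    agree by extensionality.\<close>
  moreover have "\<forall>l. l \<notin> insert i (set ?ls \<union> set ?ks) \<longrightarrow> J' l = J l" if "J' \<in> ?I" for J'
  proof -
    have "insert i (set ?ls \<union> set ?ks) = {1..n}" using i by auto
    then show ?thesis using that J by (auto simp: multi_indices_def PiE_iff extensional_def)
  qed
  ultimately show ?thesis by (simp add: qKZ_kernel_def Let_def)
qed

section \<open>The transfer matrix\<close>

text \<open>The partial fraction expansion of \<open>P / \<Prod>k. (z - w k)\<close>, its values at infinity and at \<open>0\<close>
  being compared.\<close>

lemma sum_residues_eq:
  fixes P :: "complex poly"
  assumes A: "finite A" "A \<noteq> {}" "inj_on w A" "\<And>k. k \<in> A \<Longrightarrow> w k \<noteq> 0"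
    and deg: "degree P \<le> card A"
  shows "(\<Sum>k\<in>A. poly P (w k) / (w k * (\<Prod>j\<in>A - {k}. w k - w j))) =
    coeff P (card A) - poly P 0 / (\<Prod>k\<in>A. - w k)"
proof -
  let ?n = "card A" and ?r = "\<lambda>k. \<Prod>j\<in>A - {k}. w k - w j"
  \<comment> \<open>\<open>D\<close> is the denominator, and \<open>L\<close> is the Lagrange
    interpolant of \<open>P\<close> at the nodes.\<close>
  define D where "D = (\<Prod>k\<in>A. [:- w k, 1:])"
  define L where "L = (\<Sum>k\<in>A. smult (poly P (w k) / ?r k) (\<Prod>j\<in>A - {k}. [:- w j, 1:]))"
  have n: "?n > 0" using A by (simp add: card_gt_0_iff)
  have r: "?r k \<noteq> 0" if "k \<in> A" for k
    using A that by (auto simp: inj_on_def)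
  have degD: "degree D = ?n"
    unfolding D_def by (subst degree_prod_eq_sum_degree) auto
  have coeffD: "coeff D ?n = 1"
    using lead_coeff_prod[of "\<lambda>k. [:- w k, 1:]" A] degD by (simp add: D_def)
  have degL: "degree L \<le> ?n - 1"
  proof -
    have "degree (smult c (\<Prod>j\<in>A - {k}. [:- w j, 1:])) \<le> ?n - 1" if "k \<in> A" for k c
    proof -
      have "degree (\<Prod>j\<in>A - {k}. [:- w j, 1:]) = ?n - 1"
        using that A by (subst degree_prod_eq_sum_degree) auto
      then show ?thesis using degree_smult_le[of c] by metis
    qed
    then show ?thesis unfolding L_def by (intro degree_sum_le A(1))
  qed
  \<comment> \<open>Both sides have degree at most \<open>?n\<close>, the same coefficient there,
    and the same values at \<open>?n\<close> distinct nodes.\<close>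
  have "P = smult (coeff P ?n) D + L"
  proof (rule poly_eqI_degree_lead_coeff[where n = ?n and A = "w ` A"])
    show "coeff P ?n = coeff (smult (coeff P ?n) D + L) ?n"
      using degL n by (simp add: coeffD coeff_eq_0)
    show "?n \<le> card (w ` A)" using A by (simp add: card_image)
    show "degree (smult (coeff P ?n) D + L) \<le> ?n"
      using degD degL by (intro degree_add_le order.trans[OF degree_smult_le]) auto
    show "degree P \<le> ?n" by (rule deg)
    fix z assume "z \<in> w ` A"
    then obtain k where k: "k \<in> A" "z = w k" by auto
    have "poly D z = 0" using k A by (auto simp: D_def poly_prod)
    moreover have "poly L z = (\<Sum>l\<in>A. if l = k then poly P (w k) else 0)"
      unfolding L_def poly_sum
    proof (intro sum.cong refl, goal_cases)
      case (1 l)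
      show ?case
      proof (cases "l = k")
        case False
        then have "(\<Prod>j\<in>A - {l}. poly [:- w j, 1:] z) = 0" using k A by (intro prod_zero) auto
        then show ?thesis using False by (simp add: poly_prod)
      qed (use r[OF k(1)] k in \<open>simp add: poly_prod\<close>)
    qed
    ultimately show "poly P z = poly (smult (coeff P ?n) D + L) z" using k A by simp
  qed
  then have "poly P 0 = coeff P ?n * poly D 0 + poly L 0"
    by (metis poly_add poly_smult)
  moreover have "poly D 0 = (\<Prod>k\<in>A. - w k)" by (simp add: D_def poly_prod)
  moreover have "poly L 0 = - (\<Sum>k\<in>A. poly P (w k) / (w k * ?r k)) * (\<Prod>k\<in>A. - w k)"
  proof -
    have "poly P (w k) / ?r k * (\<Prod>j\<in>A - {k}. - w j) =
        - (poly P (w k) / (w k * ?r k)) * (\<Prod>k\<in>A. - w k)" if "k \<in> A" for k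
      using A that by (simp add: prod.remove[of A k] field_simps)
    then show ?thesis
      by (simp add: L_def poly_sum poly_prod sum_distrib_right flip: sum_negf)
  qed
  moreover have "(\<Prod>k\<in>A. - w k) \<noteq> 0" using A by simp
  ultimately show ?thesis by (simp add: field_simps)
qed

text \<open>In the variables \<open>z = e\<^bsup>2x\<^esup>\<close>, \<open>w = e\<^bsup>2y\<^esup>\<close>, this is
  \<open>(z - w) sinh (x - y + \<eta>) / sinh (x - y)\<close> times the R-matrix at \<open>x - y\<close>.\<close>

definition L_poly :: "complex \<Rightarrow> complex \<Rightarrow> nat \<times> nat \<Rightarrow> nat \<times> nat \<Rightarrow> complex poly" where
  "L_poly q w = six_vertex [:- w / q, q:] [:- w, 1:] [:0, q - 1 / q:] [:(q - 1 / q) * w:]"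

text \<open>The matrix element of the trace of the twist times the monodromy matrix, cleared of
  denominators. The sites decrease, as in the qKZ operators.\<close>

definition transfer_poly ::
  "nat \<Rightarrow> nat \<Rightarrow> complex \<Rightarrow> (nat \<Rightarrow> complex) \<Rightarrow> (nat \<Rightarrow> complex) \<Rightarrow> multi_index \<Rightarrow> multi_index \<Rightarrow> complex poly"
where
  "transfer_poly n N q g w J J' =
    (\<Sum>a\<in>{1..N}. smult (g a) (monodromy N (\<lambda>k. L_poly q (w k)) (rev [1..<n+1]) J J' a a))"

text \<open>Used for evaluation, for extraction of coefficients and for scaling.\<close>

lemma six_vertex_hom:
  "h 0 = 0 \<Longrightarrow> h (six_vertex a b c d p p') = six_vertex (h a) (h b) (h c) (h d) p p'"
  by (auto simp: six_vertex_def split: prod.splits)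

text \<open>Keeps the simplifier from unfolding the list of sites at its upper end.\<close>

declare upt_Suc [simp del]

lemma degree_L_poly: "degree (L_poly q w p p') \<le> 1"
  by (auto simp: L_poly_def six_vertex_def split: prod.splits)

lemma degree_transfer_poly: "degree (transfer_poly n N q g w J J') \<le> n"
proof -
  have "degree (monodromy N (\<lambda>k. L_poly q (w k)) (rev [1..<n+1]) J J' a a) \<le> n" for a
    by (rule order.trans[OF degree_monodromy_le[OF degree_L_poly]]) simp
  then show ?thesis
    unfolding transfer_poly_def by (intro degree_sum_le order.trans[OF degree_smult_le]) auto
qed

lemma multi_indices_eq_iff:
  assumes "J \<in> multi_indices n N" "J' \<in> multi_indices n N"
  shows "(\<forall>k\<in>set (rev [1..<n+1]). J k = J' k) \<longleftrightarrow> J = J'"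
proof
  assume "\<forall>k\<in>set (rev [1..<n+1]). J k = J' k"
  then show "J = J'"
    by (intro PiE_ext[OF assms[unfolded multi_indices_def]]) auto
qed simp

lemma occurrences_upt: "card {k \<in> set (rev [1..<n+1]). J k = a} = occurrences n J a"
  unfolding occurrences_def by (rule arg_cong[where f = card]) auto

text \<open>The value at infinity: the linear coefficient of the weight for \<open>r > s\<close> is
  0, so the monodromy matrix is triangular, and its diagonal entry at \<open>a\<close> gains a
  factor \<open>q\<close> at each site in state \<open>a\<close>.\<close>

lemma transfer_poly_coeff:
  assumes J: "J \<in> multi_indices n N" "J' \<in> multi_indices n N"
  shows "coeff (transfer_poly n N q g w J J') n =
    of_bool (J = J') * (\<Sum>a\<in>{1..N}. g a * q ^ occurrences n J a)"
proof -
  let ?ks = "rev [1..<n+1]"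
  let ?B = "\<lambda>k. six_vertex (1 * q) 1 (q - 1 / q) 0 :: nat \<times> nat \<Rightarrow> nat \<times> nat \<Rightarrow> complex"
  have "coeff (monodromy N (\<lambda>k. L_poly q (w k)) ?ks J J' a a) n =
      of_bool (J = J') * q ^ occurrences n J a" if "a \<in> {1..N}" for a
  proof -
    have "coeff (monodromy N (\<lambda>k. L_poly q (w k)) ?ks J J' a a) n =
        monodromy N (\<lambda>k p p'. coeff (L_poly q (w k) p p') 1) ?ks J J' a a"
      using coeff_monodromy[of "\<lambda>k. L_poly q (w k)" N ?ks] degree_L_poly by simp
    also have "\<dots> = monodromy N ?B ?ks J J' a a"
      by (simp add: L_poly_def six_vertex_hom[where h = "\<lambda>p. coeff p (Suc 0)"])
    also have "\<dots> = (\<Prod>k\<leftarrow>?ks. ?B k (a, J k) (a, J' k))"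
      using that by (intro monodromy_triangular_diag[where f = int]) (auto simp: six_vertex_def inj_def)
    also have "\<dots> = of_bool (J = J') * q ^ occurrences n J a"
      by (subst prod_list_six_vertex_diag) (simp_all only: multi_indices_eq_iff[OF J] occurrences_upt, simp_all)
    finally show ?thesis .
  qed
  then show ?thesis
    unfolding transfer_poly_def coeff_sum coeff_smult by (simp add: sum_distrib_left mult_ac)
qed

text \<open>At z = 0 the other exchange weight vanishes, so the triangularity is reversed, and each
  site in state \<open>a\<close> contributes \<open>1 / q\<close>.\<close>

lemma transfer_poly_0:
  assumes J: "J \<in> multi_indices n N" "J' \<in> multi_indices n N"
  shows "poly (transfer_poly n N q g w J J') 0 =
    of_bool (J = J') * (\<Prod>k\<in>{1..n}. - w k) * (\<Sum>a\<in>{1..N}. g a * (1 / q) ^ occurrences n J a)"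
proof -
  let ?ks = "rev [1..<n+1]"
  let ?B = "\<lambda>k. six_vertex (- w k * (1 / q)) (- w k) 0 ((q - 1 / q) * w k)"
  have "poly (monodromy N (\<lambda>k. L_poly q (w k)) ?ks J J' a a) 0 =
      of_bool (J = J') * (\<Prod>k\<in>{1..n}. - w k) * (1 / q) ^ occurrences n J a" if "a \<in> {1..N}" for a
  proof -
    have "poly (monodromy N (\<lambda>k. L_poly q (w k)) ?ks J J' a a) 0 = monodromy N ?B ?ks J J' a a"
      by (simp add: poly_monodromy L_poly_def six_vertex_hom[where h = "\<lambda>p. poly p 0"])
    also have "\<dots> = (\<Prod>k\<leftarrow>?ks. ?B k (a, J k) (a, J' k))"
      using that
      by (intro monodromy_triangular_diag[where f = "\<lambda>a. - int a"]) (auto simp: six_vertex_def inj_def)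
    also have "\<dots> = of_bool (J = J') * (\<Prod>k\<in>set ?ks. - w k) * (1 / q) ^ occurrences n J a"
      by (subst prod_list_six_vertex_diag) (simp_all only: multi_indices_eq_iff[OF J] occurrences_upt, simp_all)
    also have "set ?ks = {1..n}" by auto
    finally show ?thesis .
  qed
  then show ?thesis
    unfolding transfer_poly_def poly_sum poly_smult by (simp add: sum_distrib_left mult_ac)
qed

section \<open>The transfer matrix at the nodes\<close>

lemma exp_minus_inverse_exp: "exp z - 1 / exp z = 2 * sinh (z :: complex)"
  unfolding sinh_field_def exp_minus by (simp add: inverse_eq_divide)

lemma exp_double_diff:
  fixes a b :: complex
  shows "exp (2 * a) - exp (2 * b) = 2 * exp (a + b) * sinh (a - b)"
proof -
  have "exp (a + b) * exp (a - b) = exp (2 * a)" "exp (a + b) * exp (- (a - b)) = exp (2 * b)"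
    by (simp_all flip: exp_add)
  moreover have "2 * exp (a + b) * sinh (a - b) =
      exp (a + b) * exp (a - b) - exp (a + b) * exp (- (a - b))"
    unfolding sinh_field_def by (simp add: right_diff_distrib)
  ultimately show ?thesis by simp
qed

lemma L_poly_eq_trig_R:
  assumes "r \<in> {1..N}" "s \<in> {1..N}" and ne: "sinh (u - v + \<eta>) \<noteq> 0"
  shows "poly (L_poly (exp \<eta>) (exp (2 * v)) (r, s) p) (exp (2 * u)) =
    2 * exp (u + v) * sinh (u - v + \<eta>) * trig_R N \<eta> (u - v) (r, s) p"
proof -
  define C where "C = 2 * exp (u + v) * sinh (u - v + \<eta>)"
  have e: "exp (u + v) * exp (u - v) = exp (2 * u)" "exp (u + v) * exp (- (u - v)) = exp (2 * v)"
    by (simp_all flip: exp_add)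
  have CS: "C * (sinh \<eta> / sinh (u - v + \<eta>) * z) = 2 * sinh \<eta> * (exp (u + v) * z)" for z
    using ne by (simp add: C_def)
  let ?w = "exp (2 * v)" and ?S = "sinh (u - v + \<eta>)"
  \<comment> \<open>Shifting \<open>u\<close> and \<open>v\<close> by \<eta>/2 in opposite
    directions keeps their sum and adds \<eta> to their difference, which reduces this weight to
    \<open>exp_double_diff\<close>.\<close>
  have 1: "poly [:- ?w / exp \<eta>, exp \<eta>:] (exp (2 * u)) = C * 1"
  proof -
    have "exp (2 * (u + \<eta> / 2)) = exp (2 * u) * exp \<eta>" "exp (2 * (v - \<eta> / 2)) = ?w / exp \<eta>"
      by (simp_all add: ring_distribs exp_add exp_diff)
    moreover have "u + \<eta> / 2 + (v - \<eta> / 2) = u + v" "u + \<eta> / 2 - (v - \<eta> / 2) = u - v + \<eta>"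
      by (simp_all add: field_simps)
    ultimately show ?thesis
      using exp_double_diff[of "u + \<eta> / 2" "v - \<eta> / 2"] by (simp add: C_def add.commute[of \<eta>])
  qed
  have 2: "poly [:- ?w, 1:] (exp (2 * u)) = C * (sinh (u - v) / ?S)"
    using ne exp_double_diff[of u v] by (simp add: C_def)
  have 3: "poly [:0, exp \<eta> - 1 / exp \<eta>:] (exp (2 * u)) = C * (sinh \<eta> / ?S * exp (u - v))"
    unfolding CS e exp_minus_inverse_exp by simp
  have 4: "poly [:(exp \<eta> - 1 / exp \<eta>) * ?w:] (exp (2 * u)) = C * (sinh \<eta> / ?S * exp (- (u - v)))"
    unfolding CS e exp_minus_inverse_exp by simp
  show ?thesis
    unfolding L_poly_def trig_R_eq_six_vertex[OF assms(1,2)] C_def[symmetric]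
      six_vertex_hom[where h = "\<lambda>p. poly p (exp (2 * u))", OF poly_0] 1 2 3 4
    by (rule six_vertex_hom[where h = "\<lambda>z. C * z", OF mult_zero_right, symmetric])
qed

text \<open>At this point the weight \<open>b\<close> vanishes and the other three coincide, leaving
  a multiple of the permutation.\<close>

lemma L_poly_node:
  "poly (L_poly q w (r, s) (r', s')) w = (q - 1 / q) * w * of_bool (r = s' \<and> r' = s)"
proof -
  have 1: "poly [:- w / q, q:] w = (q - 1 / q) * w"
    by (simp add: left_diff_distrib)
  have 2: "poly [:- w, 1:] w = 0" "poly [:0, c:] w = c * w" "poly [:c:] w = c" for c
    by simp_all
  have "six_vertex C 0 C C (r, s) (r', s') = C * of_bool (r = s' \<and> r' = s)" for C :: complex
    unfolding six_vertex_def prod.case by (metis (full_types) of_bool_eq(1,2) mult_1_right mult_zero_right)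
  then show ?thesis
    unfolding L_poly_def six_vertex_hom[where h = "\<lambda>p. poly p w", OF poly_0] 1 2 .
qed

text \<open>At \<open>z = w\<^sub>i\<close> the \<open>i\<close>-th factor degenerates to the permutation of the auxiliary and the
  \<open>i\<close>-th space, so that the trace over the auxiliary space collapses to the qKZ operator.\<close>

lemma transfer_poly_node:
  fixes x :: point
  assumes i: "i \<in> {1..n}" and J: "J \<in> multi_indices n N" "J' \<in> multi_indices n N"
    and ne: "\<And>j. j \<in> {1..n} - {i} \<Longrightarrow> sinh (x i - x j + \<eta>) \<noteq> 0"
  shows "poly (transfer_poly n N (exp \<eta>) g (\<lambda>k. exp (2 * x k)) J J') (exp (2 * x i)) =
    (exp \<eta> - 1 / exp \<eta>) * exp (2 * x i) *
    (\<Prod>j\<in>{1..n} - {i}. 2 * exp (x i + x j) * sinh (x i - x j + \<eta>)) *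
    qKZ_kernel n N \<eta> g i x J J'"
proof -
  let ?Q = "\<lambda>k p p'. poly (L_poly (exp \<eta>) (exp (2 * x k)) p p') (exp (2 * x i))"
  let ?B = "\<lambda>j. trig_R N \<eta> (x i - x j)"
  let ?s = "\<lambda>j. 2 * exp (x i + x j) * sinh (x i - x j + \<eta>)"
  let ?ks = "rev [i+1..<n+1]" and ?ls = "rev [1..<i]"
  define C where "C = (exp \<eta> - 1 / exp \<eta>) * exp (2 * x i)"
  define S where "S = (\<Prod>j\<in>{1..n} - {i}. ?s j)"
  have split: "rev [1..<n+1] = ?ks @ i # ?ls"
  proof -
    have "[1..<n+1] = [1..<i] @ [i..<n+1]"
      using i upt_add_eq_append[of 1 i "n + 1 - i"] by simp
    also have "[i..<n+1] = i # [i+1..<n+1]" using i by (simp add: upt_conv_Cons)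
    finally show ?thesis by simp
  qed
  have scale: "monodromy N ?Q ks J J' a b = prod_list (map ?s ks) * monodromy N ?B ks J J' a b"
    if "set ks \<subseteq> {1..n} - {i}" "a \<in> {1..N}" for ks a b
  proof (rule monodromy_scale[OF _ that(2)])
    fix k c p assume "k \<in> set ks" "c \<in> {1..N}"
    with that(1) have "k \<in> {1..n} - {i}" by auto
    then show "?Q k (c, J k) p = ?s k * ?B k (c, J k) p"
      using multi_indices_range[OF J(1), of k] \<open>c \<in> {1..N}\<close> ne[of k]
      by (intro L_poly_eq_trig_R) auto
  qed
  have S: "prod_list (map ?s ?ks) * prod_list (map ?s ?ls) = S"
  proof -
    have "set (?ks @ ?ls) = {1..n} - {i}" "distinct (?ks @ ?ls)" using i by auto
    then show ?thesis
      using prod.distinct_set_conv_list[of "?ks @ ?ls" ?s]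
      unfolding S_def map_append prod_list.append by (simp only:)
  qed
  have J': "J' i \<in> {1..N}" "J i \<in> {1..N}" 
    using multi_indices_range[OF J(2) i] multi_indices_range[OF J(1) i] by auto
  have "monodromy N ?Q (rev [1..<n+1]) J J' a a =
      C * S * (monodromy N ?B ?ls J J' (J i) a * monodromy N ?B ?ks J J' a (J' i))"
    if a: "a \<in> {1..N}" for a
  proof -
    \<comment> \<open>The permutation at site \<open>i\<close> forces the incoming auxiliary state
      to be \<open>J' i\<close> and starts the remaining chain in \<open>J i\<close>.\<close>
    have "monodromy N ?Q (i # ?ls) J J' c a =
        (if c = J' i then C * monodromy N ?Q ?ls J J' (J i) a else 0)" for c
    proof -
      have "monodromy N ?Q (i # ?ls) J J' c a = (\<Sum>d\<in>{1..N}.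
          if d = J i then if c = J' i then C * monodromy N ?Q ?ls J J' d a else 0 else 0)"
        unfolding monodromy.simps L_poly_node C_def[symmetric] by (intro sum.cong refl) simp
      then show ?thesis using J' by simp
    qed
    then have "monodromy N ?Q (rev [1..<n+1]) J J' a a = (\<Sum>c\<in>{1..N}.
        if c = J' i then monodromy N ?Q ?ks J J' a c * (C * monodromy N ?Q ?ls J J' (J i) a) else 0)"
      unfolding split monodromy_append[OF a] by (intro sum.cong refl) auto
    also have "\<dots> = monodromy N ?Q ?ks J J' a (J' i) * (C * monodromy N ?Q ?ls J J' (J i) a)"
      using J' by simp
    also have "monodromy N ?Q ?ks J J' a (J' i) =
        prod_list (map ?s ?ks) * monodromy N ?B ?ks J J' a (J' i)"
      using i a by (intro scale) auto
    also have "monodromy N ?Q ?ls J J' (J i) a =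
        prod_list (map ?s ?ls) * monodromy N ?B ?ls J J' (J i) a"
      using i J' by (intro scale) auto
    finally show ?thesis unfolding S[symmetric] by (simp only: mult_ac)
  qed
  then have "poly (transfer_poly n N (exp \<eta>) g (\<lambda>k. exp (2 * x k)) J J') (exp (2 * x i)) =
      (\<Sum>a\<in>{1..N}. C * S * (monodromy N ?B ?ls J J' (J i) a * (g a * monodromy N ?B ?ks J J' a (J' i))))"
    unfolding transfer_poly_def poly_sum poly_smult poly_monodromy
    by (intro sum.cong refl) (simp only: mult_ac)
  then show ?thesis
    unfolding C_def[symmetric] S_def[symmetric] qKZ_kernel_def Let_def by (simp only: sum_distrib_left)
qed

text \<open>\<open>sum_residues_eq\<close> is applied to \<open>transfer_poly\<close> at the nodes
  \<open>exp (2 * x k)\<close>. The values at infinity and at 0 carry opposite powers of q, whose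
  difference is twice a sinh.\<close>

lemma sum_qKZ_kernel:
  fixes x :: point
  assumes n: "n \<ge> 1" and \<eta>: "sinh \<eta> \<noteq> 0"
    and ne: "\<And>i j. i \<in> {1..n} \<Longrightarrow> j \<in> {1..n} \<Longrightarrow> i \<noteq> j \<Longrightarrow>
      sinh (x i - x j) \<noteq> 0 \<and> sinh (x i - x j + \<eta>) \<noteq> 0"
    and J: "J \<in> multi_indices n N" "J' \<in> multi_indices n N"
  shows "(\<Sum>i\<in>{1..n}. (\<Prod>j\<in>{1..n} - {i}. sinh (x i - x j + \<eta>) / sinh (x i - x j)) *
      qKZ_kernel n N \<eta> g i x J J') =
    of_bool (J = J') * (\<Sum>a\<in>{1..N}. g a * (sinh (\<eta> * of_nat (occurrences n J a)) / sinh \<eta>))"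
proof -
  let ?w = "\<lambda>k. exp (2 * x k)"
  let ?P = "transfer_poly n N (exp \<eta>) g ?w J J'"
  let ?K = "\<lambda>i. qKZ_kernel n N \<eta> g i x J J'"
  let ?\<pi> = "\<lambda>i. \<Prod>j\<in>{1..n} - {i}. sinh (x i - x j + \<eta>) / sinh (x i - x j)"
  \<comment> \<open>Each difference of nodes is a sinh times \<open>2 * exp (x i + x j)\<close>,
    which cancels against the normalization of the R-matrices; the factor \<open>?w i\<close> of the
    permutation cancels the one in the denominator.\<close>
  have term_eq: "poly ?P (?w i) / (?w i * (\<Prod>j\<in>{1..n} - {i}. ?w i - ?w j)) = 2 * sinh \<eta> * (?\<pi> i * ?K i)"
    if i: "i \<in> {1..n}" for i
  proof -
    have "?\<pi> i = (\<Prod>j\<in>{1..n} - {i}. 2 * exp (x i + x j) * sinh (x i - x j + \<eta>) / (?w i - ?w j))"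
      by (intro prod.cong refl) (simp add: exp_double_diff)
    also have "\<dots> = (\<Prod>j\<in>{1..n} - {i}. 2 * exp (x i + x j) * sinh (x i - x j + \<eta>)) /
        (\<Prod>j\<in>{1..n} - {i}. ?w i - ?w j)"
      by (rule prod_dividef)
    finally have \<pi>: "?\<pi> i = \<dots>" .
    have "poly ?P (?w i) = 2 * sinh \<eta> * ?w i *
        (\<Prod>j\<in>{1..n} - {i}. 2 * exp (x i + x j) * sinh (x i - x j + \<eta>)) * ?K i"
      using transfer_poly_node[OF i J, of x \<eta> g] ne i unfolding exp_minus_inverse_exp by auto
    moreover have "2 * s * w * A * K / (w * D) = 2 * s * (A / D * K)" if "w \<noteq> 0" for s w A K D :: complex
      using that by simp
    ultimately show ?thesis unfolding \<pi> by (simp only: exp_not_eq_zero not_False_eq_True)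
  qed
  have "2 * sinh \<eta> * (\<Sum>i\<in>{1..n}. ?\<pi> i * ?K i) =
      (\<Sum>i\<in>{1..n}. poly ?P (?w i) / (?w i * (\<Prod>j\<in>{1..n} - {i}. ?w i - ?w j)))"
    unfolding sum_distrib_left by (intro sum.cong refl) (simp only: term_eq)
  also have "\<dots> = coeff ?P (card {1..n}) - poly ?P 0 / (\<Prod>k\<in>{1..n}. - ?w k)"
  proof (rule sum_residues_eq)
    show "inj_on ?w {1..n}"
    proof (rule inj_onI, rule ccontr)
      fix i j assume ij: "i \<in> {1..n}" "j \<in> {1..n}" "?w i = ?w j" "i \<noteq> j"
      then have "2 * exp (x i + x j) * sinh (x i - x j) = 0"
        unfolding exp_double_diff[symmetric] by simp
      with ne[OF ij(1,2,4)] show False by simp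
    qed
    show "degree ?P \<le> card {1..n}" using degree_transfer_poly by simp
  qed (use n in auto)
  also have "\<dots> = of_bool (J = J') * (\<Sum>a\<in>{1..N}. g a * exp \<eta> ^ occurrences n J a)
      - of_bool (J = J') * (\<Sum>a\<in>{1..N}. g a * (1 / exp \<eta>) ^ occurrences n J a)"
    using transfer_poly_coeff[OF J] transfer_poly_0[OF J] by simp
  also have "\<dots> = of_bool (J = J') *
      (\<Sum>a\<in>{1..N}. g a * (exp \<eta> ^ occurrences n J a - (1 / exp \<eta>) ^ occurrences n J a))"
    by (simp add: right_diff_distrib sum_subtractf)
  also have "\<dots> = of_bool (J = J') *
      (\<Sum>a\<in>{1..N}. 2 * sinh \<eta> * (g a * (sinh (\<eta> * of_nat (occurrences n J a)) / sinh \<eta>)))"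
  proof -
    have "exp \<eta> ^ m - (1 / exp \<eta>) ^ m = 2 * sinh (\<eta> * of_nat m)" for m
      unfolding exp_minus_inverse_exp[symmetric] by (simp add: exp_of_nat2_mult power_one_over)
    then show ?thesis using \<eta> by (simp add: mult.left_commute)
  qed
  also have "\<dots> = 2 * sinh \<eta> * (of_bool (J = J') *
      (\<Sum>a\<in>{1..N}. g a * (sinh (\<eta> * of_nat (occurrences n J a)) / sinh \<eta>)))"
    unfolding sum_distrib_left[symmetric] by (rule mult.left_commute)
  finally show ?thesis
    by (rule mult_left_cancel[THEN iffD1, rotated]) (use \<eta> in simp)
qed

section \<open>Assembly of the difference equation\<close>

theorem mainTheorem3:
  fixes n N :: nat and \<eta> hbar q E :: complex and g :: "nat \<Rightarrow> complex" and M :: "nat \<Rightarrow> nat"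
    and X :: "point set" and \<Phi> :: "point \<Rightarrow> tensor_vec" and \<Psi> :: "point \<Rightarrow> complex"
  assumes "n \<ge> 1" and "N \<ge> 1"
    and "sinh \<eta> \<noteq> 0"
    and "q = exp \<eta>"
    and "diag_matrix N g \<in> GL N"
    and "(\<Sum>a\<in>{1..N}. M a) = n"
    and "admissible_domain n \<eta> hbar X"
    and "\<And>x. x \<in> X \<Longrightarrow> \<Phi> x \<in> weight_subspace n N M"
    and "solves_qKZ n N \<eta> hbar g X \<Phi>"
    and "\<Psi> = (\<lambda>x. \<Sum>J\<in>weight_indices n N M. q ^ ell n J * \<Phi> x J)"
    and "E = (\<Sum>a\<in>{1..N}. g a * (sinh (\<eta> * of_nat (M a)) / sinh \<eta>))"
  shows "\<forall>x\<in>X. (\<Sum>i\<in>{1..n}.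
            (\<Prod>j\<in>{1..n} - {i}. sinh (x i - x j + \<eta>) / sinh (x i - x j))
            * shift (\<eta> * hbar) i \<Psi> x)
         = E * \<Psi> x"
proof
  fix x assume x: "x \<in> X"
  let ?W = "weight_indices n N M" and ?I = "multi_indices n N"
  let ?\<pi> = "\<lambda>i. \<Prod>j\<in>{1..n} - {i}. sinh (x i - x j + \<eta>) / sinh (x i - x j)"
  let ?c = "\<lambda>J. exp \<eta> ^ card (inversions n J)"
  have dom: "sinh (y i - y j) \<noteq> 0 \<and> sinh (y i - y j + \<eta>) \<noteq> 0"
    if "y \<in> X" "i \<in> {1..n}" "j \<in> {1..n}" "i \<noteq> j" for y i j
    using assms(7) that unfolding admissible_domain_def by blast
  have W: "J \<in> ?I" if "J \<in> ?W" for J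
    using that by (simp add: weight_indices_def)
  have \<Psi>: "\<Psi> y = q_pairing n N M (exp \<eta>) (\<Phi> y)" for y
    unfolding assms(4,10) q_pairing_def
    by (intro sum.cong refl)
      (use W in \<open>auto simp: multi_indices_def PiE_iff ell_eq_card_inversions\<close>)
  \<comment> \<open>Under the pairing with \<Omega>, \<hbar> may be replaced by 0 in the operator,
    while the shift of the argument remains on the left.\<close>
  have shift: "shift (\<eta> * hbar) i \<Psi> x = q_pairing n N M (exp \<eta>) (qKZ_op n N \<eta> 0 g i x (\<Phi> x))"
    if i: "i \<in> {1..n}" for i
  proof -
    let ?y = "x(i := x i + \<eta> * hbar)"
    have y: "?y \<in> X"
      using assms(7) x i unfolding admissible_domain_def by blast
    have "shift (\<eta> * hbar) i \<Psi> x = q_pairing n N M (exp \<eta>) (\<Phi> ?y)"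
      by (simp only: shift_def \<Psi>)
    also have "\<dots> = q_pairing n N M (exp \<eta>) (qKZ_op n N \<eta> hbar g i x (\<Phi> x))"
      unfolding q_pairing_def
    proof (intro sum.cong refl arg_cong2[where f = "(*)"])
      fix J assume "J \<in> ?W"
      then show "\<Phi> ?y J = qKZ_op n N \<eta> hbar g i x (\<Phi> x) J"
        using assms(9) i x W unfolding solves_qKZ_def shift_def by blast
    qed
    also have "\<dots> = q_pairing n N M (exp \<eta>) (qKZ_op n N \<eta> 0 g i x (\<Phi> x))"
      unfolding qKZ_op_R_chain
    proof (rule q_pairing_R_chain_indep)
      fix j assume j: "1 \<le> j" "j < i"
      then have "j \<in> {1..n}" "i \<noteq> j" using i by auto
      \<comment> \<open>The first denominator is that of the shifted point \<open>?y\<close>, the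
        second that of \<open>x\<close>; both points lie in \<open>X\<close>.\<close>
      then show "sinh (x i - x j + \<eta> * hbar + \<eta>) \<noteq> 0 \<and> sinh (x i - x j + \<eta> * 0 + \<eta>) \<noteq> 0"
        using dom[OF x i, of j] dom[OF y i, of j] by (simp add: algebra_simps)
    qed (use i in auto)
    finally show ?thesis .
  qed
  \<comment> \<open>At \<hbar> = 0 the weighted sum of the operators is the scalar \<open>E\<close>
    on each coordinate in the weight subspace, even before pairing with \<Omega>.\<close>
  have energy: "(\<Sum>i\<in>{1..n}. ?\<pi> i * qKZ_op n N \<eta> 0 g i x (\<Phi> x) J) = E * \<Phi> x J"
    if J: "J \<in> ?W" for J
  proof -
    have occ: "occurrences n J a = M a" if "a \<in> {1..N}" for a
      using J that by (simp add: weight_indices_def)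
    have "(\<Sum>i\<in>{1..n}. ?\<pi> i * qKZ_op n N \<eta> 0 g i x (\<Phi> x) J) =
        (\<Sum>i\<in>{1..n}. \<Sum>J'\<in>?I. ?\<pi> i * qKZ_kernel n N \<eta> g i x J J' * \<Phi> x J')"
      by (intro sum.cong refl) (simp only: qKZ_op_kernel W[OF J] sum_distrib_left mult.assoc)
    also have "\<dots> = (\<Sum>J'\<in>?I. \<Sum>i\<in>{1..n}. ?\<pi> i * qKZ_kernel n N \<eta> g i x J J' * \<Phi> x J')"
      by (rule sum.swap)
    also have "\<dots> = (\<Sum>J'\<in>?I. if J = J' then E * \<Phi> x J' else 0)"
    proof (intro sum.cong refl)
      fix J' assume J': "J' \<in> ?I"
      have "(\<Sum>i\<in>{1..n}. ?\<pi> i * qKZ_kernel n N \<eta> g i x J J') = of_bool (J = J') *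
          (\<Sum>a\<in>{1..N}. g a * (sinh (\<eta> * of_nat (occurrences n J a)) / sinh \<eta>))"
        by (rule sum_qKZ_kernel[OF assms(1,3) dom[OF x] W[OF J] J'])
      also have "\<dots> = of_bool (J = J') * E"
        unfolding assms(11) by (simp add: occ)
      finally show "(\<Sum>i\<in>{1..n}. ?\<pi> i * qKZ_kernel n N \<eta> g i x J J' * \<Phi> x J') =
          (if J = J' then E * \<Phi> x J' else 0)"
        unfolding sum_distrib_right[symmetric] by simp
    qed
    also have "\<dots> = E * \<Phi> x J" using W[OF J] by simp
    finally show ?thesis .
  qed
  have "(\<Sum>i\<in>{1..n}. ?\<pi> i * shift (\<eta> * hbar) i \<Psi> x) =
      (\<Sum>i\<in>{1..n}. \<Sum>J\<in>?W. ?c J * (?\<pi> i * qKZ_op n N \<eta> 0 g i x (\<Phi> x) J))"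
    by (intro sum.cong refl) (simp only: shift q_pairing_def sum_distrib_left mult_ac)
  also have "\<dots> = (\<Sum>J\<in>?W. \<Sum>i\<in>{1..n}. ?c J * (?\<pi> i * qKZ_op n N \<eta> 0 g i x (\<Phi> x) J))"
    by (rule sum.swap)
  also have "\<dots> = (\<Sum>J\<in>?W. ?c J * (E * \<Phi> x J))"
    unfolding sum_distrib_left[symmetric] by (intro sum.cong refl) (simp only: energy)
  also have "\<dots> = E * \<Psi> x"
    unfolding \<Psi> q_pairing_def by (simp only: sum_distrib_left mult_ac)
  finally show "(\<Sum>i\<in>{1..n}. ?\<pi> i * shift (\<eta> * hbar) i \<Psi> x) = E * \<Psi> x" .
qed

end
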